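(* Let $k$ be a field, let $\Delta$ be a matroid on $[n]$ and let $I=I_\Delta\subseteq R=k[x_1,\ldots,x_n]$ be its Stanley--Reisner ideal. The following are equivalent: (1) the circuit graph $G(\Delta)$ is 2-locally connected; (2) $I$ has maximal $\ell$-th symbolic defect for all $\ell\ge 1$; (3) $I$ has maximal $\ell$-th symbolic defect for some $\ell\ge2$; (4) $\operatorname{sdefect}(I,2)=\mu(I^{(2)})-\mu(I)$; (5) for any $m_1,m_2\in G(I)$ with disjoint supports, there is $\widetilde m\in G(I)$ with $\widetilde m\notin\{m_1,m_2\}$ such that $\widetilde m$ divides $m_1m_2$.
   Context: A matroid on $[n]$ is identified with the simplicial complex whose facets are its bases. $I_\Delta=\bigcap_F(x_i: i\in[n]-F)$, intersection over the bases $F$ of $\Delta$. For a squarefree monomial ideal $I$, $I^{(\ell)}=\bigcap_{\mathfrak p\in\operatorname{Ass}(R/I)}\mathfrak p^\ell$. $\mu$ denotes the minimal number of generators of a finitely generated graded $R$-module, and $\operatorname{sdefect}(I,\ell)=\mu(I^{(\ell)}/I^\ell)$. $I$ has maximal $\ell$-th symbolic defect if $\operatorname{sdefect}(I,\ell)=\mu(I^{(\ell)})-\mu(I)$. For the monomial ideal $I$, $G(I)$ is its minimal monomial generating set; the support of a monomial is the set of variables dividing it. The circuit graph $G(\Delta)$ of a matroid $\Delta$ is the graph whose vertices are the circuits of $\Delta$, with an edge between two distinct circuits if and only if they are not disjoint. $G(\Delta)$ is 2-locally connected if for any two distinct non-adjacent vertices $C_1,C_2$ there is a vertex $\widetilde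 C\notin\{C_1,C_2\}$ such that $\widetilde C$ is adjacent to both $C_1$ and $C_2$ and $\widetilde C\subseteq C_1\cup C_2$. *)

theory Defs
  imports
    "HOL-Library.Poly_Mapping"
    "HOL-Algebra.Ideal_Product"
    "HOL-Algebra.QuotRing"
    "HOL-Algebra.Divisibility"
    "HOL-Algebra.Module"
begin

section \<open>Matroids and circuit graphs\<close>

text \<open>The ground set is \<open>{1..n}\<close>. A matroid is given by the simplicial complex of its independent
  sets, whose facets are the bases; loops are allowed.\<close>

definition matroid :: "nat \<Rightarrow> nat set set \<Rightarrow> bool" where
  "matroid n \<Delta> \<longleftrightarrow>
     \<Delta> \<subseteq> Pow {1..n} \<and> {} \<in> \<Delta> \<and>
     (\<forall>A\<in>\<Delta>. \<forall>B\<subseteq>A. B \<in> \<Delta>) \<and>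
     (\<forall>A\<in>\<Delta>. \<forall>B\<in>\<Delta>. card A < card B \<longrightarrow> (\<exists>x\<in>B - A. insert x A \<in> \<Delta>))"

definition facets :: "nat set set \<Rightarrow> nat set set" where
  "facets \<Delta> = {F \<in> \<Delta>. \<forall>A\<in>\<Delta>. F \<subseteq> A \<longrightarrow> A = F}"

definition circuits :: "nat \<Rightarrow> nat set set \<Rightarrow> nat set set" where
  "circuits n \<Delta> = {C. C \<subseteq> {1..n} \<and> C \<notin> \<Delta> \<and> (\<forall>A. A \<subset> C \<longrightarrow> A \<in> \<Delta>)}"

text \<open>A graph is a pair of a vertex set and a set of two-element edges; the vertices of the
  circuit graph are themselves sets.\<close>

definition circuit_graph :: "nat \<Rightarrow> nat set set \<Rightarrow> nat set set \<times> nat set set set" where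
  "circuit_graph n \<Delta> =
     (circuits n \<Delta>,
      {{C, D} |C D. C \<in> circuits n \<Delta> \<and> D \<in> circuits n \<Delta> \<and> C \<noteq> D \<and> C \<inter> D \<noteq> {}})"

definition two_locally_connected :: "'v set set \<times> 'v set set set \<Rightarrow> bool" where
  "two_locally_connected G \<longleftrightarrow>
     (\<forall>C1\<in>fst G. \<forall>C2\<in>fst G. C1 \<noteq> C2 \<and> {C1, C2} \<notin> snd G \<longrightarrow>
        (\<exists>C\<in>fst G. C \<notin> {C1, C2} \<and> {C, C1} \<in> snd G \<and> {C, C2} \<in> snd G \<and> C \<subseteq> C1 \<union> C2))"


section \<open>Modules and numbers of generators\<close>

text \<open>The HOL-Algebra record of modules extends that of rings; the fields \<^const>\<open>monoid.mult\<close> and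
  \<^const>\<open>monoid.one\<close> of a module carry no meaning.\<close>

definition ideal_module :: "('a, 'm) ring_scheme \<Rightarrow> 'a set \<Rightarrow> ('a, 'a) module" where
  "ideal_module R I =
     \<lparr>carrier = I, monoid.mult = (\<otimes>\<^bsub>R\<^esub>), one = \<one>\<^bsub>R\<^esub>, zero = \<zero>\<^bsub>R\<^esub>, add = (\<oplus>\<^bsub>R\<^esub>), smult = (\<otimes>\<^bsub>R\<^esub>)\<rparr>"

definition quotient_module :: "('a, 'b, 'm) module_scheme \<Rightarrow> 'b set \<Rightarrow> ('a, 'b set) module" where
  "quotient_module M N =
     \<lparr>carrier = a_rcosets\<^bsub>M\<^esub> N, monoid.mult = undefined, one = undefined, zero = N, add = set_add M,
      smult = (\<lambda>r X. \<Union>x\<in>X. N +>\<^bsub>M\<^esub> (r \<odot>\<^bsub>M\<^esub> x))\<rparr>"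

definition generates :: "('a, 'm) ring_scheme \<Rightarrow> ('a, 'b, 'k) module_scheme \<Rightarrow> 'b set \<Rightarrow> bool" where
  "generates R M S \<longleftrightarrow>
     S \<subseteq> carrier M \<and> (\<forall>N. submodule N R M \<and> S \<subseteq> N \<longrightarrow> N = carrier M)"

text \<open>The least size of a generating set, homogeneous or not. For finitely generated graded modules
  over a standard graded polynomial ring this is also the size of every minimal homogeneous
  generating set (graded Nakayama). The value is meaningful for finitely generated modules only.\<close>

definition num_gens :: "('a, 'm) ring_scheme \<Rightarrow> ('a, 'b, 'k) module_scheme \<Rightarrow> nat" where
  "num_gens R M = (LEAST d. \<exists>S. finite S \<and> card S = d \<and> generates R M S)"


section \<open>Symbolic powers and symbolic defect\<close>

definition ass_primes :: "('a, 'm) ring_scheme \<Rightarrow> ('a, 'b, 'k) module_scheme \<Rightarrow> 'a set set" where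
  "ass_primes R M =
     {P. primeideal P R \<and> (\<exists>m\<in>carrier M. P = {r \<in> carrier R. r \<odot>\<^bsub>M\<^esub> m = \<zero>\<^bsub>M\<^esub>})}"

text \<open>Powers of ideals are powers in the commutative monoid \<^const>\<open>ideals_set\<close> of all ideals under
  \<^const>\<open>ideal_prod\<close>, with the unit ideal as zeroth power.\<close>

abbreviation ideal_power :: "('a, 'm) ring_scheme \<Rightarrow> 'a set \<Rightarrow> nat \<Rightarrow> 'a set" where
  "ideal_power R I l \<equiv> I [^]\<^bsub>ideals_set R\<^esub> l"

text \<open>For ideals without embedded primes, in particular squarefree monomial ideals with the primes
  generated by variables. Intersecting with the carrier only matters when there is no associated
  prime, that is, for the unit ideal.\<close>

definition symbolic_power :: "('a, 'm) ring_scheme \<Rightarrow> 'a set \<Rightarrow> nat \<Rightarrow> 'a set" where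
  "symbolic_power R I l =
     carrier R \<inter>
     (\<Inter>P\<in>ass_primes R (quotient_module (ideal_module R (carrier R)) I). ideal_power R P l)"

definition sdefect :: "('a, 'm) ring_scheme \<Rightarrow> 'a set \<Rightarrow> nat \<Rightarrow> nat" where
  "sdefect R I l =
     num_gens R (quotient_module (ideal_module R (symbolic_power R I l)) (ideal_power R I l))"

text \<open>The difference is taken in the integers, since truncated subtraction could hide a negative value.\<close>

definition maximal_sdefect :: "('a, 'm) ring_scheme \<Rightarrow> 'a set \<Rightarrow> nat \<Rightarrow> bool" where
  "maximal_sdefect R I l \<longleftrightarrow>
     int (sdefect R I l) =
       int (num_gens R (ideal_module R (symbolic_power R I l))) - int (num_gens R (ideal_module R I))"


section \<open>Polynomial rings, monomials and Stanley--Reisner ideals\<close>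

text \<open>A polynomial maps finitely many exponent vectors (finitely supported functions on variable
  indices) to nonzero coefficients.\<close>

type_synonym 'k mpolynomial = "(nat \<Rightarrow>\<^sub>0 nat) \<Rightarrow>\<^sub>0 'k"

definition poly_ring :: "nat \<Rightarrow> 'k::field mpolynomial ring" where
  "poly_ring n =
     \<lparr>carrier = {p. \<forall>m\<in>Poly_Mapping.keys p. Poly_Mapping.keys m \<subseteq> {1..n}},
      monoid.mult = (*), one = 1, zero = 0, add = (+)\<rparr>"

definition var :: "nat \<Rightarrow> 'k::field mpolynomial" where
  "var i = Poly_Mapping.single (Poly_Mapping.single i 1) 1"

definition monomials :: "nat \<Rightarrow> 'k::field mpolynomial set" where
  "monomials n = {Poly_Mapping.single e 1 |e. Poly_Mapping.keys e \<subseteq> {1..n}}"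

definition support :: "nat \<Rightarrow> 'k::field mpolynomial \<Rightarrow> nat set" where
  "support n m = {i \<in> {1..n}. var i divides\<^bsub>poly_ring n\<^esub> m}"

text \<open>For a monomial ideal exactly one set has this property.\<close>

definition min_monomial_gens :: "nat \<Rightarrow> 'k::field mpolynomial set \<Rightarrow> 'k mpolynomial set" where
  "min_monomial_gens n I =
     (THE S. S \<subseteq> monomials n \<and> Idl\<^bsub>poly_ring n\<^esub> S = I \<and> (\<forall>T. T \<subset> S \<longrightarrow> Idl\<^bsub>poly_ring n\<^esub> T \<noteq> I))"

definition stanley_reisner_ideal :: "nat \<Rightarrow> nat set set \<Rightarrow> 'k::field mpolynomial set" where
  "stanley_reisner_ideal n \<Delta> = (\<Inter>F\<in>facets \<Delta>. Idl\<^bsub>poly_ring n\<^esub> (var ` ({1..n} - F)))"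

end

(* Monomials are identified with exponent vectors, and all ideals in question are monomial. Taking the
   coefficients at the minimal exponents of a monomial ideal kills everything multiplied by a variable,
   so sdefect(I, l) counts the minimal generators of the symbolic power I^(l) outside I^l. Hence the
   defect is maximal iff the number of minimal generators of I^(l) lying in I^l is mu(I), that is, the
   number of circuits. Such generators are products x_C1 ... x_Cl over circuits, and the l-th powers of
   the x_C are always among them. So the question is whether a product with two distinct factors can be
   a minimal generator. If C1 and C2 meet in e, or are disjoint but C1 \<union> C2 contains a third circuit and
   e \<in> C1 is arbitrary, circuit elimination shows that no basis F avoids e and misses exactly one element
   of each Ci; so x_C1 x_C2 / x_e stays in I^(2). If C1 and C2 are the only circuits in their disjoint
   union, then (C1 \<union> C2) - {e, f} lies in a basis for all e \<in> C1 and f \<in> C2, and x_C1^(l-1) x_C2 is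
   minimal for every l >= 2. *)

theory Submission
  imports "HOL.Vector_Spaces" "HOL-Library.Multiset" Defs
begin

section \<open>Circuits and bases\<close>

text \<open>The associated primes of I are the P_F generated by the variables outside a basis F, and
  a monomial lies in P_F^l iff its degree in those variables is at least l. Membership in I^(l) is
  thus a list of linear inequalities, one per basis, and x_C has degree |C - F| >= 1 in each. A
  product of l circuit monomials is minimal in I^(l) exactly when each of its variables is missed by
  a basis whose inequality is tight, and tight means that the basis omits just one element of every
  factor. This is why bases with |C1 - F| + |C2 - F| = 2 decide the matter. Symbolic powers are
  defined through associated primes, and numbers of generators through arbitrary, possibly
  inhomogeneous, generating sets, so both have to be computed before anything can be counted. The
  failing direction starts at l = 2 because the first symbolic power is I itself.\<close>

lemma circuit_ne: "matroid n \<Delta> \<Longrightarrow> C \<in> circuits n \<Delta> \<Longrightarrow> C \<noteq> {}"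
  by (auto simp: matroid_def circuits_def)

lemma circuit_finite: "C \<in> circuits n \<Delta> \<Longrightarrow> finite C"
  by (auto simp: circuits_def intro: finite_subset)

lemma finite_circuits: "finite (circuits n \<Delta>)"
  by (rule finite_subset[of _ "Pow {1..n}"]) (auto simp: circuits_def)

lemma circuit_subset_eq:
  assumes "C \<in> circuits n \<Delta>" "D \<in> circuits n \<Delta>" "C \<subseteq> D"
  shows "C = D"
  using assms unfolding circuits_def by blast

lemma matroid_subset: "matroid n \<Delta> \<Longrightarrow> A \<in> \<Delta> \<Longrightarrow> B \<subseteq> A \<Longrightarrow> B \<in> \<Delta>"
  unfolding matroid_def by blast

lemma matroid_finite: "matroid n \<Delta> \<Longrightarrow> A \<in> \<Delta> \<Longrightarrow> finite A"
  unfolding matroid_def by (auto intro: finite_subset)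

lemma dependent_contains_circuit:
  assumes "D \<subseteq> {1..n}" "D \<notin> \<Delta>"
  obtains C where "C \<in> circuits n \<Delta>" "C \<subseteq> D"
proof -
  have "finite D"
    using assms(1) by (rule finite_subset) simp
  then have "\<exists>C\<in>circuits n \<Delta>. C \<subseteq> D"
    using assms
  proof (induction D rule: finite_psubset_induct)
    case (psubset D)
    show ?case
    proof (cases "\<forall>A. A \<subset> D \<longrightarrow> A \<in> \<Delta>")
      case True
      with psubset.prems have "D \<in> circuits n \<Delta>"
        by (auto simp: circuits_def)
      then show ?thesis by blast
    next
      case False
      then obtain A where "A \<subset> D" "A \<notin> \<Delta>" by blast
      with psubset.IH[of A] psubset.prems show ?thesis by blast
    qed
  qed
  with that show ?thesis by blast
qed

lemma circuit_not_subset_independent: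
  assumes "matroid n \<Delta>" "C \<in> circuits n \<Delta>" "A \<in> \<Delta>"
  shows "\<not> C \<subseteq> A"
  using assms by (auto simp: circuits_def dest: matroid_subset)

lemma circuit_remove_independent:
  assumes "C \<in> circuits n \<Delta>" "e \<in> C"
  shows "C - {e} \<in> \<Delta>"
  using assms by (auto simp: circuits_def)

lemma finite_matroid: "matroid n \<Delta> \<Longrightarrow> finite \<Delta>"
  by (rule finite_subset[of _ "Pow {1..n}"]) (auto simp: matroid_def)

lemma finite_facets: "matroid n \<Delta> \<Longrightarrow> finite (facets \<Delta>)"
  by (rule finite_subset[OF _ finite_matroid]) (auto simp: facets_def)

lemma facet_independent: "F \<in> facets \<Delta> \<Longrightarrow> F \<in> \<Delta>"
  by (simp add: facets_def)

lemma facet_subset: "matroid n \<Delta> \<Longrightarrow> F \<in> facets \<Delta> \<Longrightarrow> F \<subseteq> {1..n}"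
  by (auto simp: facets_def matroid_def)

lemma facet_subset_eq: "F \<in> facets \<Delta> \<Longrightarrow> G \<in> facets \<Delta> \<Longrightarrow> F \<subseteq> G \<Longrightarrow> F = G"
  by (auto simp: facets_def)

lemma independent_subset_facet:
  assumes "matroid n \<Delta>" "A \<in> \<Delta>"
  obtains F where "F \<in> facets \<Delta>" "A \<subseteq> F"
proof -
  obtain F where "F \<in> \<Delta>" "A \<subseteq> F" "\<forall>B\<in>\<Delta>. F \<subseteq> B \<longrightarrow> F = B"
    using finite_has_maximal2[OF finite_matroid[OF assms(1)] assms(2)] by auto
  with that show ?thesis
    by (auto simp: facets_def)
qed

lemma facets_ne: "matroid n \<Delta> \<Longrightarrow> facets \<Delta> \<noteq> {}"
  by (metis empty_iff independent_subset_facet matroid_def)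

section \<open>Circuit elimination and bases relative to two circuits\<close>

text \<open>The matroid is given by the augmentation axiom, so elimination is derived from it. If U
  - {e} were independent, a maximal independent J with C1 - {f} \<subseteq> J \<subseteq> U would
  miss two elements of U, hence be smaller than U - {e} and extendable inside U.\<close>

lemma circuit_elimination:
  assumes M: "matroid n \<Delta>" and C: "C1 \<in> circuits n \<Delta>" "C2 \<in> circuits n \<Delta>" "C1 \<noteq> C2"
    and e: "e \<in> C1" "e \<in> C2"
  obtains C where "C \<in> circuits n \<Delta>" "C \<subseteq> C1 \<union> C2 - {e}"
proof -
  define U where "U = C1 \<union> C2"
  have U: "finite U" "U \<subseteq> {1..n}"
    using C by (auto simp: U_def circuits_def intro: finite_subset)
  have "U - {e} \<notin> \<Delta>"
  proof
    assume ind: "U - {e} \<in> \<Delta>"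
    \<comment> \<open>Taking f outside C2 makes it differ from the element g of C2 that J misses;
      two missing elements beat the single e.\<close>
    obtain f where f: "f \<in> C1" "f \<notin> C2"
      using circuit_subset_eq[OF C(1,2)] C(3) by blast
    define S where "S = {J \<in> \<Delta>. C1 - {f} \<subseteq> J \<and> J \<subseteq> U}"
    have "finite S"
      unfolding S_def using finite_matroid[OF M] by simp
    moreover have "C1 - {f} \<in> S"
      using circuit_remove_independent[OF C(1) f(1)] by (auto simp: S_def U_def)
    ultimately obtain J where J: "J \<in> S" "\<forall>B\<in>S. J \<subseteq> B \<longrightarrow> J = B"
      using finite_has_maximal2[of S] by metis
    have J': "J \<in> \<Delta>" "C1 - {f} \<subseteq> J" "J \<subseteq> U"
      using J(1) by (auto simp: S_def)
    have "f \<notin> J"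
      using circuit_not_subset_independent[OF M C(1) J'(1)] J'(2) by blast
    moreover obtain g where g: "g \<in> C2" "g \<notin> J"
      using circuit_not_subset_independent[OF M C(2) J'(1)] by blast
    ultimately have "J \<subseteq> U - {f, g}" "f \<noteq> g"
      using J' f by auto
    then have "card J \<le> card (U - {f, g})"
      using U by (intro card_mono) auto
    also have "\<dots> = card U - 2"
      using f(1) g(1) \<open>f \<noteq> g\<close> U(1) by (subst card_Diff_subset) (auto simp: U_def)
    also have "\<dots> < card (U - {e})"
    proof -
      have "card {f, g} \<le> card U"
        using f(1) g(1) U(1) by (intro card_mono) (auto simp: U_def)
      moreover have "card (U - {e}) = card U - 1"
        using e(1) U(1) by (subst card_Diff_subset) (auto simp: U_def)
      ultimately show ?thesis
        using \<open>f \<noteq> g\<close> by simp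
    qed
    finally obtain x where x: "x \<in> (U - {e}) - J" "insert x J \<in> \<Delta>"
      using M ind J'(1) unfolding matroid_def by blast
    then have "insert x J \<in> S"
      using J' by (auto simp: S_def)
    with J(2) x(1) show False by blast
  qed
  moreover have "U - {e} \<subseteq> {1..n}"
    using U(2) by blast
  ultimately obtain C where "C \<in> circuits n \<Delta>" "C \<subseteq> U - {e}"
    using dependent_contains_circuit[of "U - {e}" n \<Delta>] by blast
  with that show ?thesis
    unfolding U_def by blast
qed

text \<open>Both circuits lie in F together with e, so eliminating e would leave a circuit inside
  the independent set F. This is uniqueness of the fundamental circuit of e with respect to
  F.\<close>

lemma fundamental_circuit_unique:
  assumes M: "matroid n \<Delta>" and C: "C1 \<in> circuits n \<Delta>" "C2 \<in> circuits n \<Delta>"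
    and F: "F \<in> \<Delta>" "C1 - F \<subseteq> {e}" "C2 - F \<subseteq> {e}"
  shows "C1 = C2"
proof (rule ccontr)
  assume ne: "C1 \<noteq> C2"
  have "e \<in> C1" "e \<in> C2"
    using circuit_not_subset_independent[OF M C(1) F(1)]
      circuit_not_subset_independent[OF M C(2) F(1)] F by auto
  from circuit_elimination[OF M C ne this] obtain C
    where "C \<in> circuits n \<Delta>" "C \<subseteq> C1 \<union> C2 - {e}" by blast
  with F circuit_not_subset_independent[OF M _ F(1), of C] show False
    by blast
qed

lemma facet_meets_circuit_except:
  assumes M: "matroid n \<Delta>" and C: "C \<in> circuits n \<Delta>" "e \<in> C"
  obtains F where "F \<in> facets \<Delta>" "C - F = {e}"
proof -
  obtain F where F: "F \<in> facets \<Delta>" "C - {e} \<subseteq> F"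
    using independent_subset_facet[OF M circuit_remove_independent[OF C]] .
  with circuit_not_subset_independent[OF M C(1) facet_independent[OF F(1)]] C(2)
  have "C - F = {e}" by blast
  with F(1) that show ?thesis by blast
qed

lemma card_circuit_diff_pos:
  assumes "matroid n \<Delta>" "C \<in> circuits n \<Delta>" "F \<in> \<Delta>"
  shows "1 \<le> card (C - F)"
proof -
  have "C - F \<noteq> {}" "finite (C - F)"
    using circuit_not_subset_independent[OF assms] circuit_finite[OF assms(2)] by auto
  then show ?thesis
    by (simp add: Suc_leI card_gt_0_iff)
qed

text \<open>Otherwise F omits one element of each circuit, and D, not being inside F, contains one
  of the two. Eliminating it from D and the circuit it belongs to gives a circuit that must be the
  fundamental circuit of the other omitted element, hence the other of C1, C2. By disjointness that
  one is then contained in D, against incomparability of circuits.\<close>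

lemma disjoint_circuits_corank:
  assumes M: "matroid n \<Delta>" and C: "C1 \<in> circuits n \<Delta>" "C2 \<in> circuits n \<Delta>"
    and D: "D \<in> circuits n \<Delta>" "D \<noteq> C1" "D \<noteq> C2" "D \<subseteq> C1 \<union> C2"
    and disj: "C1 \<inter> C2 = {}" and F: "F \<in> \<Delta>"
  shows "3 \<le> card (C1 - F) + card (C2 - F)"
proof (rule ccontr)
  assume "\<not> ?thesis"
  with card_circuit_diff_pos[OF M C(1) F] card_circuit_diff_pos[OF M C(2) F]
  have "card (C1 - F) = 1" "card (C2 - F) = 1"
    by auto
  then obtain e f where ef: "C1 - F = {e}" "C2 - F = {f}"
    by (auto simp: card_1_singleton_iff)
  \<comment> \<open>Stated for generic C, C', x, y because it is applied twice, with the roles of C1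
    and C2 exchanged.\<close>
  have *: False
    if "C \<in> circuits n \<Delta>" "C' \<in> circuits n \<Delta>" "C \<inter> C' = {}" "D \<subseteq> C \<union> C'" "D \<noteq> C" "D \<noteq> C'"
      "C - F = {x}" "C' - F = {y}" "x \<in> D" for C C' x y
  proof -
    have "x \<in> C"
      using that by auto
    from circuit_elimination[OF M that(1) D(1) that(5)[symmetric] this that(9)] obtain B
      where B: "B \<in> circuits n \<Delta>" "B \<subseteq> C \<union> D - {x}" by blast
    have "B - F \<subseteq> {y}"
      using B that by blast
    then have "B = C'"
      using fundamental_circuit_unique[OF M B(1) that(2) F] that(8) by blast
    with B that(3) have "C' \<subseteq> D"
      by blast
    with circuit_subset_eq[OF that(2) D(1)] that(6) show False
      by blast
  qed
  have "\<not> D \<subseteq> F"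
    using circuit_not_subset_independent[OF M D(1) F] .
  then obtain z where "z \<in> D" "z \<notin> F"
    by blast
  with D(4) have "z \<in> C1 - F \<or> z \<in> C2 - F"
    by blast
  then have "e \<in> D \<or> f \<in> D"
    using ef \<open>z \<in> D\<close> by auto
  moreover have "C2 \<inter> C1 = {}" "D \<subseteq> C2 \<union> C1"
    using disj D(4) by auto
  ultimately show False
    using *[OF C disj D(4) D(2,3) ef] *[OF C(2,1) _ _ D(3,2) ef(2,1)] by metis
qed

section \<open>Third circuits inside the union of two circuits\<close>

text \<open>The common form of conditions (1) and (5), through which all equivalences pass.
  Adjacency of the third circuit to the other two is left out because it is automatic.\<close>

definition circuit_connected :: "nat \<Rightarrow> nat set set \<Rightarrow> bool" where
  "circuit_connected n \<Delta> \<longleftrightarrow>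
     (\<forall>C1\<in>circuits n \<Delta>. \<forall>C2\<in>circuits n \<Delta>. C1 \<inter> C2 = {} \<longrightarrow>
        (\<exists>C\<in>circuits n \<Delta>. C \<noteq> C1 \<and> C \<noteq> C2 \<and> C \<subseteq> C1 \<union> C2))"

text \<open>A third circuit inside C1 \<union> C2 that avoided one of them would be contained in the
  other, so it meets both. Disjoint circuits are distinct since circuits are nonempty.\<close>

lemma two_locally_connected_circuit_graph:
  assumes M: "matroid n \<Delta>"
  shows "two_locally_connected (circuit_graph n \<Delta>) \<longleftrightarrow> circuit_connected n \<Delta>"
proof -
  have edge: "{C, D} \<in> snd (circuit_graph n \<Delta>) \<longleftrightarrow> C \<noteq> D \<and> C \<inter> D \<noteq> {}"
    if "C \<in> circuits n \<Delta>" "D \<in> circuits n \<Delta>" for C D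
    using that by (auto simp: circuit_graph_def doubleton_eq_iff)
  have meets: "C \<inter> C1 \<noteq> {} \<and> C \<inter> C2 \<noteq> {}"
    if "C1 \<in> circuits n \<Delta>" "C2 \<in> circuits n \<Delta>" "C \<in> circuits n \<Delta>" "C \<noteq> C1" "C \<noteq> C2" "C \<subseteq> C1 \<union> C2"
    for C C1 C2
    using that circuit_subset_eq[OF that(3,1)] circuit_subset_eq[OF that(3,2)] by blast
  have V: "fst (circuit_graph n \<Delta>) = circuits n \<Delta>"
    by (simp add: circuit_graph_def)
  have inner: "(\<exists>C\<in>circuits n \<Delta>. C \<notin> {C1, C2} \<and> {C, C1} \<in> snd (circuit_graph n \<Delta>) \<and>
        {C, C2} \<in> snd (circuit_graph n \<Delta>) \<and> C \<subseteq> C1 \<union> C2) \<longleftrightarrow>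
      (\<exists>C\<in>circuits n \<Delta>. C \<noteq> C1 \<and> C \<noteq> C2 \<and> C \<subseteq> C1 \<union> C2)"
    if "C1 \<in> circuits n \<Delta>" "C2 \<in> circuits n \<Delta>" for C1 C2
  proof (intro bex_cong refl)
    fix C assume C: "C \<in> circuits n \<Delta>"
    show "C \<notin> {C1, C2} \<and> {C, C1} \<in> snd (circuit_graph n \<Delta>) \<and>
        {C, C2} \<in> snd (circuit_graph n \<Delta>) \<and> C \<subseteq> C1 \<union> C2 \<longleftrightarrow>
      C \<noteq> C1 \<and> C \<noteq> C2 \<and> C \<subseteq> C1 \<union> C2"
      unfolding edge[OF C that(1)] edge[OF C that(2)] using meets[OF that C] by (simp, argo)
  qed
  have outer: "C1 \<noteq> C2 \<and> {C1, C2} \<notin> snd (circuit_graph n \<Delta>) \<longleftrightarrow> C1 \<inter> C2 = {}"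
    if "C1 \<in> circuits n \<Delta>" "C2 \<in> circuits n \<Delta>" for C1 C2
    using edge[OF that] circuit_ne[OF M that(1)] by auto
  show ?thesis
    unfolding two_locally_connected_def circuit_connected_def V
    by (intro ball_cong refl) (simp only: inner outer)
qed

text \<open>The bound 3, one more than 2, is what allows dividing the product of the monomials of \<open>C1\<close> and \<open>C2\<close>
  by the variable of \<open>e\<close> without leaving the second symbolic power.\<close>

lemma circuit_connected_excess:
  assumes M: "matroid n \<Delta>" and conn: "circuit_connected n \<Delta>"
    and C: "C1 \<in> circuits n \<Delta>" "C2 \<in> circuits n \<Delta>" "C1 \<noteq> C2"
  obtains e where "e \<in> C1" "\<And>F. F \<in> \<Delta> \<Longrightarrow> e \<notin> F \<Longrightarrow> 3 \<le> card (C1 - F) + card (C2 - F)"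
proof (cases "C1 \<inter> C2 = {}")
  case True
  with conn C(1,2) have "\<exists>D\<in>circuits n \<Delta>. D \<noteq> C1 \<and> D \<noteq> C2 \<and> D \<subseteq> C1 \<union> C2"
    unfolding circuit_connected_def by simp
  then obtain D where "D \<in> circuits n \<Delta>" "D \<noteq> C1" "D \<noteq> C2" "D \<subseteq> C1 \<union> C2"
    by metis
  then have "3 \<le> card (C1 - F) + card (C2 - F)" if "F \<in> \<Delta>" for F
    using disjoint_circuits_corank[OF M C(1,2) _ _ _ _ True that] by blast
  with that circuit_ne[OF M C(1)] show ?thesis
    by (meson all_not_in_conv)
next
  case False
  then obtain e where e: "e \<in> C1" "e \<in> C2" by blast
  have "3 \<le> card (C1 - F) + card (C2 - F)" if F: "F \<in> \<Delta>" "e \<notin> F" for F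
  proof (rule ccontr)
    assume "\<not> ?thesis"
    with card_circuit_diff_pos[OF M C(1) F(1)] card_circuit_diff_pos[OF M C(2) F(1)]
    have "card (C1 - F) = 1" "card (C2 - F) = 1"
      by auto
    \<comment> \<open>Each difference is a singleton that contains e, so both circuits would be the
      fundamental circuit of e.\<close>
    then have "C1 - F \<subseteq> {e}" "C2 - F \<subseteq> {e}"
      using e F by (metis DiffI card_1_singletonE singletonD order_refl)+
    then show False
      using fundamental_circuit_unique[OF M C(1,2) F(1)] C(3) by blast
  qed
  with that e show ?thesis by blast
qed

text \<open>Removing one element from each of the only two circuits leaves no circuit, hence an
  independent set. A basis containing it must still miss e and f, since it contains neither C1 nor
  C2.\<close>

lemma not_circuit_connected_facet:
  assumes M: "matroid n \<Delta>" and C: "C1 \<in> circuits n \<Delta>" "C2 \<in> circuits n \<Delta>"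
    and only: "\<And>C. C \<in> circuits n \<Delta> \<Longrightarrow> C \<subseteq> C1 \<union> C2 \<Longrightarrow> C = C1 \<or> C = C2"
    and disj: "C1 \<inter> C2 = {}" and e: "e \<in> C1" "f \<in> C2"
  obtains F where "F \<in> facets \<Delta>" "C1 - F = {e}" "C2 - F = {f}"
proof -
  have "C1 \<union> C2 - {e, f} \<in> \<Delta>"
  proof (rule ccontr)
    assume "\<not> ?thesis"
    moreover have "C1 \<union> C2 - {e, f} \<subseteq> {1..n}"
      using C by (auto simp: circuits_def)
    ultimately obtain C where "C \<in> circuits n \<Delta>" "C \<subseteq> C1 \<union> C2 - {e, f}"
      using dependent_contains_circuit by metis
    with only[of C] e show False by blast
  qed
  then obtain F where F: "F \<in> facets \<Delta>" "C1 \<union> C2 - {e, f} \<subseteq> F"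
    using independent_subset_facet[OF M] by metis
  have "C1 - F = {e}" "C2 - F = {f}"
    using F(2) disj e circuit_not_subset_independent[OF M C(1) facet_independent[OF F(1)]]
      circuit_not_subset_independent[OF M C(2) facet_independent[OF F(1)]] by blast+
  with F(1) that show ?thesis by blast
qed

section \<open>Modules\<close>

lemma ideal_module_simps [simp]:
  "carrier (ideal_module R J) = J"
  "\<zero>\<^bsub>ideal_module R J\<^esub> = \<zero>\<^bsub>R\<^esub>"
  "x \<oplus>\<^bsub>ideal_module R J\<^esub> y = x \<oplus>\<^bsub>R\<^esub> y"
  "x \<odot>\<^bsub>ideal_module R J\<^esub> y = x \<otimes>\<^bsub>R\<^esub> y"
  by (simp_all add: ideal_module_def)

lemma module_ideal_module:
  assumes "cring R" "ideal J R"
  shows "module R (ideal_module R J)"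
proof -
  interpret cring R by fact
  interpret ideal J R by fact
  have neg: "\<exists>y\<in>J. x \<oplus>\<^bsub>R\<^esub> y = \<zero>\<^bsub>R\<^esub>" if "x \<in> J" for x
    using that by (intro bexI[of _ "\<ominus>\<^bsub>R\<^esub> x"]) (auto simp: r_neg)
  show ?thesis
  proof (rule moduleI)
    show "abelian_group (ideal_module R J)"
      by (rule abelian_groupI) (auto simp: a_ac neg)
  qed (auto simp: l_distr r_distr m_assoc I_l_closed intro: assms)
qed

lemma submodule_ideal_module:
  assumes "cring R" "ideal J R" "ideal K R" "K \<subseteq> J"
  shows "submodule K R (ideal_module R J)"
proof -
  interpret K: ideal K R by fact
  have "module R ((ideal_module R J)\<lparr>carrier := K\<rparr>)"
    using module_ideal_module[OF assms(1,3)] by (simp add: ideal_module_def)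
  with module.module_incl_imp_submodule[OF module_ideal_module[OF assms(1,2)]] assms(4)
  show ?thesis by simp
qed

lemma quotient_module_simps [simp]:
  "carrier (quotient_module M N) = a_rcosets\<^bsub>M\<^esub> N"
  "\<zero>\<^bsub>quotient_module M N\<^esub> = N"
  "X \<oplus>\<^bsub>quotient_module M N\<^esub> Y = X <+>\<^bsub>M\<^esub> Y"
  by (simp_all add: quotient_module_def)

lemma abelian_subgroup_submodule:
  assumes "module R M" "submodule N R M"
  shows "abelian_subgroup N M"
  using assms by (intro abelian_subgroupI3 additive_subgroupI)
    (auto simp: module_def submodule_def)

text \<open>Scalar multiplication on cosets is defined as a union over all representatives. Since N
  absorbs scalars, this is a union of equal cosets.\<close>

lemma quotient_module_smult:
  assumes "module R M" "submodule N R M" "r \<in> carrier R" "x \<in> carrier M"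
  shows "r \<odot>\<^bsub>quotient_module M N\<^esub> (N +>\<^bsub>M\<^esub> x) = N +>\<^bsub>M\<^esub> (r \<odot>\<^bsub>M\<^esub> x)"
proof -
  interpret M: module R M by fact
  interpret N: abelian_subgroup N M
    by (rule abelian_subgroup_submodule) fact+
  have *: "N +>\<^bsub>M\<^esub> (r \<odot>\<^bsub>M\<^esub> y) = N +>\<^bsub>M\<^esub> (r \<odot>\<^bsub>M\<^esub> x)" if y: "y \<in> N +>\<^bsub>M\<^esub> x" for y
  proof -
    from y obtain k where k: "k \<in> N" "y = k \<oplus>\<^bsub>M\<^esub> x"
      by (auto simp: a_r_coset_def')
    then have "r \<odot>\<^bsub>M\<^esub> y = r \<odot>\<^bsub>M\<^esub> k \<oplus>\<^bsub>M\<^esub> r \<odot>\<^bsub>M\<^esub> x"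
      using assms by (simp add: M.smult_r_distr)
    moreover have "r \<odot>\<^bsub>M\<^esub> k \<in> N"
      using submodule.smult_closed[OF assms(2,3) k(1)] .
    ultimately have "r \<odot>\<^bsub>M\<^esub> y \<in> N +>\<^bsub>M\<^esub> (r \<odot>\<^bsub>M\<^esub> x)"
      by (auto simp: a_r_coset_def')
    then show ?thesis
      using N.a_repr_independence' assms(3,4) by simp
  qed
  have "N +>\<^bsub>M\<^esub> x \<noteq> {}"
    using N.a_rcos_self[OF assms(4)] by blast
  then have "(\<Union>y\<in>N +>\<^bsub>M\<^esub> x. N +>\<^bsub>M\<^esub> (r \<odot>\<^bsub>M\<^esub> y)) = N +>\<^bsub>M\<^esub> (r \<odot>\<^bsub>M\<^esub> x)"
    by (rule SUP_eq_const) (rule *)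
  then show ?thesis
    by (simp add: quotient_module_def)
qed

lemma module_quotient_module:
  assumes "module R M" "submodule N R M"
  shows "module R (quotient_module M N)"
proof -
  interpret M: module R M by fact
  interpret N: abelian_subgroup N M
    by (rule abelian_subgroup_submodule) fact+
  note smult = quotient_module_smult[OF assms]
  have coset: "\<exists>x\<in>carrier M. X = N +>\<^bsub>M\<^esub> x" if "X \<in> a_rcosets\<^bsub>M\<^esub> N" for X
    using that by (auto simp: A_RCOSETS_def')
  show ?thesis
  proof (rule moduleI)
    show "cring R" by (rule M.R.is_cring)
    have neg: "\<exists>y\<in>carrier M. N +>\<^bsub>M\<^esub> (y \<oplus>\<^bsub>M\<^esub> x) = N" if "x \<in> carrier M" for x
      using that by (intro bexI[of _ "\<ominus>\<^bsub>M\<^esub> x"]) (auto simp: M.l_neg N.a_subset)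
    have neg': "\<exists>Y\<in>a_rcosets\<^bsub>M\<^esub> N. Y <+>\<^bsub>M\<^esub> X = N" if X: "X \<in> a_rcosets\<^bsub>M\<^esub> N" for X
    proof -
      from coset[OF X] obtain x where x: "x \<in> carrier M" "X = N +>\<^bsub>M\<^esub> x" by blast
      with neg obtain y where y: "y \<in> carrier M" "N +>\<^bsub>M\<^esub> (y \<oplus>\<^bsub>M\<^esub> x) = N" by blast
      with x show ?thesis
        by (intro bexI[of _ "N +>\<^bsub>M\<^esub> y"]) (auto simp: N.a_rcos_sum intro!: M.a_rcosetsI N.a_subset)
    qed
    show "abelian_group (quotient_module M N)"
      by (rule abelian_groupI)
        (auto dest!: coset simp: N.a_rcos_sum M.a_ac N.a_subgroup_in_rcosets N.rcosets_add_eq neg'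
          intro!: M.a_rcosetsI N.a_subset)
  qed (auto dest!: coset simp: smult N.a_rcos_sum M.smult_l_distr M.smult_r_distr M.smult_assoc1
      intro!: M.a_rcosetsI N.a_subset)
qed

lemma num_gens_eqI:
  assumes "finite E" "generates R M (f ` E)"
    and "\<And>T. finite T \<Longrightarrow> generates R M T \<Longrightarrow> card E \<le> card T"
  shows "num_gens R M = card E"
  unfolding num_gens_def
proof (rule Least_equality)
  have "card (f ` E) = card E"
    using assms by (intro antisym card_image_le) auto
  then show "\<exists>S. finite S \<and> card S = card E \<and> generates R M S"
    using assms by (intro exI[of _ "f ` E"]) auto
qed (use assms(3) in auto)

section \<open>Exponent vectors\<close>

abbreviation lookup :: "('a \<Rightarrow>\<^sub>0 'b::zero) \<Rightarrow> 'a \<Rightarrow> 'b" where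
  "lookup \<equiv> Poly_Mapping.lookup"

abbreviation keys :: "('a \<Rightarrow>\<^sub>0 'b::zero) \<Rightarrow> 'a set" where
  "keys \<equiv> Poly_Mapping.keys"

abbreviation single :: "'a \<Rightarrow> 'b \<Rightarrow> ('a \<Rightarrow>\<^sub>0 'b::zero)" where
  "single \<equiv> Poly_Mapping.single"

type_synonym expo = "nat \<Rightarrow>\<^sub>0 nat"

definition expo_le :: "expo \<Rightarrow> expo \<Rightarrow> bool" (infix \<open>\<preceq>\<close> 50) where
  "e \<preceq> f \<longleftrightarrow> (\<forall>i. lookup e i \<le> lookup f i)"

lemma expo_le_refl [simp]: "e \<preceq> e"
  by (simp add: expo_le_def)

lemma expo_le_trans: "e \<preceq> f \<Longrightarrow> f \<preceq> g \<Longrightarrow> e \<preceq> g"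
  unfolding expo_le_def using le_trans by blast

lemma expo_le_antisym: "e \<preceq> f \<Longrightarrow> f \<preceq> e \<Longrightarrow> e = f"
  by (rule poly_mapping_eqI) (simp add: expo_le_def le_antisym)

lemma expo_le_add [simp]: "e \<preceq> e + d" "e \<preceq> d + e"
  by (simp_all add: expo_le_def lookup_add)

lemma expo_le_add_mono: "e \<preceq> e' \<Longrightarrow> f \<preceq> f' \<Longrightarrow> e + f \<preceq> e' + f'"
  by (simp add: expo_le_def lookup_add add_mono)

lemma expo_le_addE:
  assumes "e \<preceq> f"
  obtains d where "f = e + d"
proof
  show "f = e + (f - e)"
    by (rule poly_mapping_eqI) (use assms in \<open>simp add: expo_le_def lookup_add lookup_minus\<close>)
qed

lemma keys_add_expo: "keys (e + f :: expo) = keys e \<union> keys f"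
  by (auto simp: in_keys_iff lookup_add)

definition expos :: "nat \<Rightarrow> expo set" where
  "expos n = {e. keys e \<subseteq> {1..n}}"

lemma zero_in_expos [simp]: "0 \<in> expos n"
  by (simp add: expos_def)

lemma add_in_expos [simp]: "e + f \<in> expos n \<longleftrightarrow> e \<in> expos n \<and> f \<in> expos n"
  by (simp add: expos_def keys_add_expo)

text \<open>The degree in the variables of W. For W the complement of a basis F it is the order of
  the monomial along the prime P_F; for W = {1..n} it is the total degree.\<close>

definition weight :: "nat set \<Rightarrow> expo \<Rightarrow> nat" where
  "weight W e = (\<Sum>i\<in>W. lookup e i)"

lemma weight_add [simp]: "weight W (e + f) = weight W e + weight W f"
  by (simp add: weight_def lookup_add sum.distrib)

lemma weight_zero [simp]: "weight W 0 = 0"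
  by (simp add: weight_def)

lemma weight_single: "finite W \<Longrightarrow> weight W (single i c) = (if i \<in> W then c else 0)"
  unfolding weight_def lookup_single when_def by (rule sum.delta')

lemma weight_mono: "e \<preceq> f \<Longrightarrow> weight W e \<le> weight W f"
  by (auto simp: weight_def expo_le_def intro: sum_mono)

lemma weight_zero_expos:
  assumes "e \<in> expos n" "weight {1..n} e = 0"
  shows "e = 0"
proof (rule poly_mapping_eqI)
  fix i
  have "lookup e i = 0" if "i \<in> {1..n}"
    using assms(2) that by (simp add: weight_def)
  moreover have "lookup e i = 0" if "i \<notin> {1..n}"
  proof -
    have "i \<notin> keys e"
      using assms(1) that unfolding expos_def by blast
    then show ?thesis
      by (simp add: in_keys_iff)
  qed
  ultimately have "lookup e i = 0"
    by blast
  then show "lookup e i = lookup 0 i"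
    by simp
qed

text \<open>The cofactor of e in f has total degree zero.\<close>

lemma weight_eq_imp_eq:
  assumes "e \<preceq> f" "f \<in> expos n" "weight {1..n} f \<le> weight {1..n} e"
  shows "e = f"
proof -
  obtain d where "f = e + d"
    using expo_le_addE[OF assms(1)] .
  with assms weight_zero_expos[of d n] show ?thesis
    by simp
qed

text \<open>The exponent of the squarefree monomial x_C. A sum over an infinite set is 0, so the
  facts about it ask for a finite C.\<close>

definition ind :: "nat set \<Rightarrow> expo" where
  "ind C = (\<Sum>i\<in>C. single i 1)"

lemma lookup_ind: "finite C \<Longrightarrow> lookup (ind C) i = (if i \<in> C then 1 else 0)"
  unfolding ind_def lookup_sum lookup_single when_def by (rule sum.delta)

lemma keys_ind [simp]: "finite C \<Longrightarrow> keys (ind C) = C"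
  by (auto simp: in_keys_iff lookup_ind split: if_splits)

lemma ind_le_iff: "finite C \<Longrightarrow> ind C \<preceq> e \<longleftrightarrow> C \<subseteq> keys e"
  by (auto simp: expo_le_def lookup_ind in_keys_iff subset_iff Suc_le_eq)

lemma weight_ind:
  assumes "finite C" "finite W"
  shows "weight W (ind C) = card (C \<inter> W)"
proof -
  have "weight W (ind C) = (\<Sum>i\<in>W. if i \<in> C then 1 else 0)"
    unfolding weight_def using assms(1) by (intro sum.cong refl) (rule lookup_ind)
  also have "\<dots> = card (W \<inter> C)"
    using assms(2) by (simp only: card_eq_sum sum.inter_restrict)
  finally show ?thesis
    by (simp only: Int_commute)
qed

text \<open>The exponent sets of monomial ideals; the empty set stands for the zero ideal.\<close>

definition expo_ideal :: "nat \<Rightarrow> expo set \<Rightarrow> bool" where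
  "expo_ideal n A \<longleftrightarrow> A \<subseteq> expos n \<and> (\<forall>e\<in>A. \<forall>d\<in>expos n. e + d \<in> A)"

lemma expo_ideal_up:
  assumes "expo_ideal n A" "e \<in> A" "f \<in> expos n" "e \<preceq> f"
  shows "f \<in> A"
proof -
  obtain d where "f = e + d"
    using expo_le_addE[OF assms(4)] .
  with assms show ?thesis
    by (simp add: expo_ideal_def)
qed

definition min_expos :: "expo set \<Rightarrow> expo set" where
  "min_expos A = {e \<in> A. \<forall>f\<in>A. f \<preceq> e \<longrightarrow> f = e}"

text \<open>Induction on the total degree, which drops strictly when passing to a proper
  divisor.\<close>

lemma min_expo_below:
  assumes "A \<subseteq> expos n" "e \<in> A"
  obtains f where "f \<in> min_expos A" "f \<preceq> e"
proof -
  have "\<exists>f\<in>min_expos A. f \<preceq> e"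
    using assms(2)
  proof (induction "weight {1..n} e" arbitrary: e rule: less_induct)
    case less
    show ?case
    proof (cases "e \<in> min_expos A")
      case True
      then show ?thesis
        using expo_le_refl by blast
    next
      case False
      then obtain f where f: "f \<in> A" "f \<preceq> e" "f \<noteq> e"
        using less.prems by (auto simp: min_expos_def)
      with weight_eq_imp_eq[of f e n] less.prems assms(1)
      have "weight {1..n} f < weight {1..n} e"
        by (metis not_less subsetD)
      with less.hyps[OF _ f(1)] f(2) show ?thesis
        using expo_le_trans by blast
    qed
  qed
  with that show ?thesis by blast
qed

definition expo_sum :: "expo set \<Rightarrow> expo set \<Rightarrow> expo set" where
  "expo_sum A B = {a + b |a b. a \<in> A \<and> b \<in> B}"

section \<open>Monomial ideals\<close>

lemma poly_ring_simps [simp]: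
  "x \<otimes>\<^bsub>poly_ring n\<^esub> y = x * y"
  "x \<oplus>\<^bsub>poly_ring n\<^esub> y = x + y"
  "\<one>\<^bsub>poly_ring n\<^esub> = 1"
  "\<zero>\<^bsub>poly_ring n\<^esub> = 0"
  by (simp_all add: poly_ring_def)

text \<open>The k-span of the monomials with exponent in A, for any set A. The ring itself and all
  ideals in question have this form, so that inclusions and intersections become statements about
  sets of exponents.\<close>

definition mono_ideal :: "expo set \<Rightarrow> 'k::field mpolynomial set" where
  "mono_ideal A = {p. keys p \<subseteq> A}"

lemma carrier_poly_ring [simp]: "carrier (poly_ring n) = mono_ideal (expos n)"
  by (auto simp: poly_ring_def mono_ideal_def expos_def)

lemma mono_ideal_zero [simp]: "0 \<in> mono_ideal A"
  by (simp add: mono_ideal_def)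

lemma mono_ideal_add [intro]: "p \<in> mono_ideal A \<Longrightarrow> q \<in> mono_ideal A \<Longrightarrow> p + q \<in> mono_ideal A"
  using keys_add[of p q] by (auto simp: mono_ideal_def)

lemma mono_ideal_uminus [intro]: "p \<in> mono_ideal A \<Longrightarrow> - p \<in> mono_ideal A"
  by (simp add: mono_ideal_def subset_iff in_keys_iff)

lemma mono_ideal_mult: "p \<in> mono_ideal A \<Longrightarrow> q \<in> mono_ideal B \<Longrightarrow> p * q \<in> mono_ideal (expo_sum A B)"
  using keys_mult[of p q] by (fastforce simp: mono_ideal_def expo_sum_def)

lemma single_in_mono_ideal [simp]: "single e c \<in> mono_ideal A \<longleftrightarrow> c = 0 \<or> e \<in> A"
  by (auto simp: mono_ideal_def)

lemma mono_ideal_mono: "A \<subseteq> B \<Longrightarrow> mono_ideal A \<subseteq> mono_ideal B"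
  by (auto simp: mono_ideal_def)

lemma mono_ideal_subset_iff [simp]:
  "(mono_ideal A :: 'k::field mpolynomial set) \<subseteq> mono_ideal B \<longleftrightarrow> A \<subseteq> B"
proof
  assume sub: "(mono_ideal A :: 'k mpolynomial set) \<subseteq> mono_ideal B"
  show "A \<subseteq> B"
  proof
    fix e assume "e \<in> A"
    then have "single e (1 :: 'k) \<in> mono_ideal A" by simp
    with sub have "single e (1 :: 'k) \<in> mono_ideal B" by (rule subsetD)
    then show "e \<in> B" by simp
  qed
qed (rule mono_ideal_mono)

lemma mono_ideal_eq_iff [simp]:
  "(mono_ideal A :: 'k::field mpolynomial set) = mono_ideal B \<longleftrightarrow> A = B"
  by (simp add: set_eq_subset)

lemma mono_ideal_Inter: "\<F> \<noteq> {} \<Longrightarrow> (\<Inter>F\<in>\<F>. mono_ideal (A F)) = mono_ideal (\<Inter>F\<in>\<F>. A F)"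
  by (auto simp: mono_ideal_def)

lemma poly_mapping_sum_single: "(p :: 'a \<Rightarrow>\<^sub>0 'b::comm_monoid_add) = (\<Sum>e\<in>keys p. single e (lookup p e))"
proof (rule poly_mapping_eqI)
  fix k
  have "(\<Sum>e\<in>keys p. lookup (single e (lookup p e)) k) = (if k \<in> keys p then lookup p k else 0)"
    unfolding lookup_single when_def by (rule sum.delta) simp
  then show "lookup p k = lookup (\<Sum>e\<in>keys p. single e (lookup p e)) k"
    by (simp add: lookup_sum in_keys_iff)
qed

text \<open>A polynomial is the sum of its terms. Only closure under sums is asked of N, so the rule
  serves generated ideals, products of ideals, submodules and preimages of submodules alike.\<close>

lemma mono_ideal_subsetI:
  fixes N :: "'k::field mpolynomial set"
  assumes "0 \<in> N" "\<And>p q. p \<in> N \<Longrightarrow> q \<in> N \<Longrightarrow> p + q \<in> N"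
    and "\<And>e c. e \<in> A \<Longrightarrow> single e c \<in> N"
  shows "mono_ideal A \<subseteq> N"
proof
  fix p :: "'k mpolynomial" assume p: "p \<in> mono_ideal A"
  have "(\<Sum>e\<in>K. single e (lookup p e)) \<in> N" if "finite K" "K \<subseteq> A" for K
    using that by (induction K rule: finite_induct) (auto intro: assms)
  from this[of "keys p"] p show "p \<in> N"
    by (simp add: mono_ideal_def flip: poly_mapping_sum_single)
qed

lemma cring_poly_ring: "cring (poly_ring n :: 'k::field mpolynomial ring)"
proof -
  have sub: "expo_sum (expos n) (expos n) \<subseteq> expos n"
    by (auto simp: expo_sum_def)
  have prod: "p * q \<in> mono_ideal (expos n)"
    if "p \<in> mono_ideal (expos n)" "q \<in> mono_ideal (expos n)" for p q :: "'k mpolynomial"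
    using mono_ideal_mult[OF that] mono_ideal_mono[OF sub] by (rule rev_subsetD)
  show ?thesis
  proof (rule cringI)
    show "abelian_group (poly_ring n :: 'k mpolynomial ring)"
    proof (rule abelian_groupI)
      fix x :: "'k mpolynomial" assume "x \<in> carrier (poly_ring n)"
      then show "\<exists>y\<in>carrier (poly_ring n). y \<oplus>\<^bsub>poly_ring n\<^esub> x = \<zero>\<^bsub>poly_ring n\<^esub>"
        by (intro bexI[of _ "- x"]) auto
    qed (auto simp: ac_simps)
    show "comm_monoid (poly_ring n :: 'k mpolynomial ring)"
      by (rule comm_monoidI) (auto simp: ac_simps prod simp flip: single_one)
  qed (simp add: distrib_right)
qed

lemma poly_ring_minus:
  fixes x :: "'k::field mpolynomial"
  shows "x \<in> carrier (poly_ring n) \<Longrightarrow> \<ominus>\<^bsub>poly_ring n\<^esub> x = - x"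
  using cring.axioms(1)[OF cring_poly_ring]
  by (intro abelian_group.minus_equality) (auto simp: ring_def)

lemma expo_ideal_subset: "expo_ideal n A \<Longrightarrow> A \<subseteq> expos n"
  by (simp add: expo_ideal_def)

lemma expo_ideal_expos [simp]: "expo_ideal n (expos n)"
  by (simp add: expo_ideal_def)

lemma ideal_mono_ideal:
  assumes "expo_ideal n A"
  shows "ideal (mono_ideal A) (poly_ring n :: 'k::field mpolynomial ring)"
proof -
  interpret cring "poly_ring n :: 'k mpolynomial ring"
    by (rule cring_poly_ring)
  have sub: "(mono_ideal A :: 'k mpolynomial set) \<subseteq> mono_ideal (expos n)"
    using assms by (simp add: expo_ideal_subset)
  have subA: "expo_sum A (expos n) \<subseteq> A"
    using assms by (auto simp: expo_ideal_def expo_sum_def)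
  have mult: "p * q \<in> mono_ideal A" if "p \<in> mono_ideal A" "q \<in> mono_ideal (expos n)"
    for p q :: "'k mpolynomial"
    using mono_ideal_mult[OF that] mono_ideal_mono[OF subA] by (rule rev_subsetD)
  show ?thesis
  proof (rule idealI)
    show "ring (poly_ring n :: 'k mpolynomial ring)" ..
    show "subgroup (mono_ideal A) (add_monoid (poly_ring n :: 'k mpolynomial ring))"
    proof (rule add.subgroupI)
      show "mono_ideal A \<noteq> ({} :: 'k mpolynomial set)"
        using mono_ideal_zero by blast
      show "\<ominus>\<^bsub>poly_ring n\<^esub> p \<in> mono_ideal A" if "p \<in> mono_ideal A" for p :: "'k mpolynomial"
      proof -
        have "p \<in> carrier (poly_ring n)"
          using sub that by (simp only: carrier_poly_ring subsetD)
        from poly_ring_minus[OF this] that show ?thesis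
          by (simp only: mono_ideal_uminus)
      qed
    qed (use sub in auto)
  qed (auto simp: mult mult.commute)
qed

lemma ideal_single_closed:
  assumes "ideal J (poly_ring n :: 'k::field mpolynomial ring)" "e \<in> expos n" "single e 1 \<in> J"
    "f \<in> expos n" "e \<preceq> f"
  shows "single f c \<in> J"
proof -
  interpret ideal J "poly_ring n" by fact
  obtain d where d: "f = e + d"
    using expo_le_addE[OF assms(5)] .
  with assms(4) have "single d c \<in> carrier (poly_ring n)"
    by simp
  from I_r_closed[OF assms(3) this] d show ?thesis
    by (simp add: mult_single)
qed

definition up_set :: "nat \<Rightarrow> expo set \<Rightarrow> expo set" where
  "up_set n E = {f \<in> expos n. \<exists>e\<in>E. e \<preceq> f}"

lemma expo_ideal_up_set: "expo_ideal n (up_set n E)"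
  unfolding expo_ideal_def up_set_def using expo_le_trans[OF _ expo_le_add(1)] by auto

lemma subset_up_set: "E \<subseteq> expos n \<Longrightarrow> E \<subseteq> up_set n E"
  unfolding up_set_def using expo_le_refl by blast

lemma up_set_min_expos:
  assumes "expo_ideal n A"
  shows "up_set n (min_expos A) = A"
proof
  show "up_set n (min_expos A) \<subseteq> A"
    using expo_ideal_up[OF assms] by (auto simp: up_set_def min_expos_def)
  show "A \<subseteq> up_set n (min_expos A)"
  proof
    fix e assume e: "e \<in> A"
    obtain f where "f \<in> min_expos A" "f \<preceq> e"
      using min_expo_below[OF expo_ideal_subset[OF assms] e] .
    moreover have "e \<in> expos n"
      using expo_ideal_subset[OF assms] e by (rule subsetD)
    ultimately show "e \<in> up_set n (min_expos A)"
      unfolding up_set_def by blast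
  qed
qed

lemma genideal_monomials:
  assumes "E \<subseteq> expos n"
  shows "Idl\<^bsub>poly_ring n\<^esub> ((\<lambda>e. single e 1) ` E) = (mono_ideal (up_set n E) :: 'k::field mpolynomial set)"
proof
  interpret cring "poly_ring n :: 'k mpolynomial ring"
    by (rule cring_poly_ring)
  have "(\<lambda>e. single e 1) ` E \<subseteq> (mono_ideal (up_set n E) :: 'k mpolynomial set)"
    using subset_up_set[OF assms] by auto
  then show "Idl\<^bsub>poly_ring n\<^esub> ((\<lambda>e. single e 1) ` E) \<subseteq> (mono_ideal (up_set n E) :: 'k mpolynomial set)"
    by (intro genideal_minimal ideal_mono_ideal expo_ideal_up_set)
  have sub: "(\<lambda>e. single e 1) ` E \<subseteq> carrier (poly_ring n :: 'k mpolynomial ring)"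
    using assms by auto
  interpret G: ideal "Idl\<^bsub>poly_ring n\<^esub> ((\<lambda>e. single e (1 :: 'k)) ` E)" "poly_ring n :: 'k mpolynomial ring"
    by (rule genideal_ideal[OF sub])
  show "mono_ideal (up_set n E) \<subseteq> Idl\<^bsub>poly_ring n\<^esub> ((\<lambda>e. single e (1 :: 'k)) ` E)"
  proof (rule mono_ideal_subsetI)
    show "0 \<in> Idl\<^bsub>poly_ring n\<^esub> ((\<lambda>e. single e (1 :: 'k)) ` E)"
      using G.zero_closed by simp
    show "p + q \<in> Idl\<^bsub>poly_ring n\<^esub> ((\<lambda>e. single e (1 :: 'k)) ` E)"
      if "p \<in> Idl\<^bsub>poly_ring n\<^esub> ((\<lambda>e. single e (1 :: 'k)) ` E)"
        "q \<in> Idl\<^bsub>poly_ring n\<^esub> ((\<lambda>e. single e (1 :: 'k)) ` E)" for p q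
      using G.a_closed[OF that] by simp
    fix f and c :: 'k assume "f \<in> up_set n E"
    then obtain e where e: "e \<in> E" "e \<preceq> f" "f \<in> expos n"
      by (auto simp: up_set_def)
    have "single e 1 \<in> Idl\<^bsub>poly_ring n\<^esub> ((\<lambda>e. single e (1 :: 'k)) ` E)"
      using genideal_self[OF sub] e(1) by (meson image_eqI subsetD)
    then show "single f c \<in> Idl\<^bsub>poly_ring n\<^esub> ((\<lambda>e. single e (1 :: 'k)) ` E)"
      using G.ideal_axioms e assms by (intro ideal_single_closed[of _ n e f]) auto
  qed
qed

lemma ideal_prod_mono_ideal:
  assumes "expo_ideal n A" "expo_ideal n B"
  shows "ideal_prod (poly_ring n) (mono_ideal A) (mono_ideal B) =
    (mono_ideal (expo_sum A B) :: 'k::field mpolynomial set)"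
proof
  show "ideal_prod (poly_ring n) (mono_ideal A) (mono_ideal B) \<subseteq>
      (mono_ideal (expo_sum A B) :: 'k mpolynomial set)"
  proof
    fix p :: "'k mpolynomial"
    assume "p \<in> ideal_prod (poly_ring n) (mono_ideal A) (mono_ideal B)"
    then show "p \<in> mono_ideal (expo_sum A B)"
      by (induction rule: ideal_prod.induct) (auto intro: mono_ideal_mult)
  qed
  show "mono_ideal (expo_sum A B) \<subseteq>
      (ideal_prod (poly_ring n) (mono_ideal A) (mono_ideal B) :: 'k mpolynomial set)"
  proof (rule mono_ideal_subsetI)
    show "0 \<in> (ideal_prod (poly_ring n) (mono_ideal A) (mono_ideal B) :: 'k mpolynomial set)"
      \<comment> \<open>The inductive product of ideals has only products and sums as introduction
        rules, so zero enters as 0 * 0.\<close>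
      using ideal_prod.prod[of 0 "mono_ideal A" 0 "mono_ideal B" "poly_ring n"] by simp
    show "p + q \<in> ideal_prod (poly_ring n) (mono_ideal A) (mono_ideal B)"
      if "p \<in> ideal_prod (poly_ring n) (mono_ideal A) (mono_ideal B)"
        "q \<in> ideal_prod (poly_ring n) (mono_ideal A) (mono_ideal B)" for p q :: "'k mpolynomial"
      using ideal_prod.sum[OF that] by simp
    fix f and c :: 'k assume "f \<in> expo_sum A B"
    then obtain a b where ab: "a \<in> A" "b \<in> B" "f = a + b"
      by (auto simp: expo_sum_def)
    have "single a c \<otimes>\<^bsub>poly_ring n\<^esub> single b 1 \<in> ideal_prod (poly_ring n) (mono_ideal A) (mono_ideal B)"
      using ab by (intro ideal_prod.prod) auto
    then show "single f c \<in> ideal_prod (poly_ring n) (mono_ideal A) (mono_ideal B)"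
      using ab by (simp add: mult_single)
  qed
qed

lemma expo_ideal_sum:
  assumes "expo_ideal n A" "expo_ideal n B"
  shows "expo_ideal n (expo_sum A B)"
  unfolding expo_ideal_def
proof (intro conjI ballI)
  show "expo_sum A B \<subseteq> expos n"
    using assms by (auto simp: expo_ideal_def expo_sum_def)
  fix e d assume ed: "e \<in> expo_sum A B" "d \<in> expos n"
  then obtain a b where "a \<in> A" "b \<in> B" "e = a + b"
    unfolding expo_sum_def by blast
  moreover from this ed assms(2) have "b + d \<in> B"
    by (simp add: expo_ideal_def)
  ultimately have "a \<in> A" "b + d \<in> B" "e + d = a + (b + d)"
    by (simp_all add: add.assoc)
  then show "e + d \<in> expo_sum A B"
    unfolding expo_sum_def by blast
qed

text \<open>The family B is a parameter, pinned down by its recursion, so that closed forms can be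
  inserted: weight conditions for the powers of P_F, products of circuits for the powers of
  I.\<close>

lemma ideal_power_mono_ideal:
  fixes A :: "expo set" and B :: "nat \<Rightarrow> expo set"
  assumes "expo_ideal n A" "B 0 = expos n" "\<And>l. B (Suc l) = expo_sum (B l) A"
  shows "expo_ideal n (B l)"
    and "ideal_power (poly_ring n) (mono_ideal A) l = (mono_ideal (B l) :: 'k::field mpolynomial set)"
proof -
  show B: "expo_ideal n (B l)" for l
    by (induction l) (simp_all add: assms expo_ideal_sum)
  show "ideal_power (poly_ring n) (mono_ideal A) l = (mono_ideal (B l) :: 'k mpolynomial set)"
  proof (induction l)
    case 0
    show ?case
      by (simp add: nat_pow_def ideals_set_def assms)
  next
    case (Suc l)
    then show ?case
      using ideal_prod_mono_ideal[OF B[of l] assms(1), where 'k = 'k]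
      by (simp add: nat_pow_def ideals_set_def assms(3))
  qed
qed

section \<open>Numbers of generators of monomial ideals and their quotients\<close>

text \<open>The linear projection onto the monomials in E. For E the minimal exponents of a monomial
  ideal J it represents J -> J/mJ, with m the ideal of the variables; for E the exponents supported
  on F it is a substitution of zeros.\<close>

definition restr :: "expo set \<Rightarrow> 'k::field mpolynomial \<Rightarrow> 'k mpolynomial" where
  "restr E p = Poly_Mapping.mapp (\<lambda>e c. if e \<in> E then c else 0) p"

lemma lookup_restr: "lookup (restr E p) e = (if e \<in> E then lookup p e else 0)"
  by (simp add: restr_def lookup_mapp when_def in_keys_iff)

lemma restr_add: "restr E (p + q) = restr E p + restr E q"
  by (rule poly_mapping_eqI) (simp add: lookup_restr lookup_add)

lemma restr_eq_0: "p \<in> mono_ideal A \<Longrightarrow> A \<inter> E = {} \<Longrightarrow> restr E p = 0"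
  by (rule poly_mapping_eqI) (auto simp: lookup_restr mono_ideal_def in_keys_iff)

lemma restr_single: "e \<in> E \<Longrightarrow> restr E (single e c) = single e c"
  by (rule poly_mapping_eqI) (auto simp: lookup_restr lookup_single when_def)

lemma lookup_scale: "lookup (single 0 c * p) e = (c * lookup p e :: 'k::field)"
  by (simp add: map.rep_eq when_def flip: mult_map_scale_conv_mult)

text \<open>The constant term of the factor \<open>r\<close> alone matters, since no proper divisor of \<open>g\<close> occurs in \<open>p\<close>.\<close>

lemma lookup_mult_min_expo:
  assumes "p \<in> mono_ideal A" "g \<in> min_expos A"
  shows "lookup (r * p) g = lookup r 0 * (lookup p g :: 'k::field)"
proof -
  define r' where "r' = r - single 0 (lookup r 0)"
  have r': "0 \<notin> keys r'"
    by (simp add: r'_def in_keys_iff lookup_minus)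
  have "g \<notin> keys (r' * p)"
  proof
    assume "g \<in> keys (r' * p)"
    with keys_mult[of r' p] obtain a b where ab: "g = a + b" "a \<in> keys r'" "b \<in> keys p"
      by blast
    then have "b \<in> A" "b \<preceq> g"
      using assms(1) by (auto simp: mono_ideal_def)
    with assms(2) have "b = g"
      by (simp add: min_expos_def)
    with ab r' show False
      by simp
  qed
  moreover have "r * p = r' * p + single 0 (lookup r 0) * p"
    by (simp add: r'_def flip: distrib_right)
  ultimately show ?thesis
    by (simp add: lookup_add lookup_scale in_keys_iff)
qed

text \<open>The ring acts on J/mJ through its residue field k, that is, through constant
  terms.\<close>

lemma restr_min_expos_mult:
  assumes "p \<in> mono_ideal A" "E \<subseteq> min_expos A"
  shows "restr E (r * p) = single 0 (lookup r 0) * restr E p"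
proof (rule poly_mapping_eqI)
  fix e
  have "lookup (r * p) e = lookup r 0 * lookup p e" if "e \<in> E"
    using lookup_mult_min_expo[OF assms(1)] assms(2) that by blast
  then show "lookup (restr E (r * p)) e = lookup (single 0 (lookup r 0) * restr E p) e"
    by (simp add: lookup_restr lookup_scale)
qed

text \<open>Constant polynomials act as scalars. This makes the dimension theory of vector spaces
  available for counting generators.\<close>

interpretation mpoly: vector_space "\<lambda>(c::'k::field) (p::'k mpolynomial). single 0 c * p"
proof
  show "single 0 (1 :: 'k) * x = x" for x :: "'k mpolynomial"
    by (simp add: single_one)
qed (simp_all add: algebra_simps single_add mult_single)

lemma single_one_eq_iff: "single e (1 :: 'k::zero_neq_one) = single f 1 \<longleftrightarrow> e = f"
  by (auto dest: arg_cong[where f = keys])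

lemma independent_singles: "mpoly.independent ((\<lambda>e. single e (1 :: 'k::field)) ` E)"
  unfolding mpoly.dependent_explicit
proof (intro notI, elim exE conjE bexE)
  fix t :: "'k mpolynomial set" and u v
  assume t: "finite t" "t \<subseteq> (\<lambda>e. single e 1) ` E" "(\<Sum>v\<in>t. single 0 (u v) * v) = 0"
    and v: "v \<in> t" "u v \<noteq> 0"
  obtain e where e: "v = single e 1"
    using t(2) v(1) by blast
  \<comment> \<open>Comparing coefficients at e isolates u v, as distinct monomials have disjoint
    supports.\<close>
  have "lookup (single 0 (u w) * w) e = (if w = v then u v else 0)" if "w \<in> t" for w
  proof -
    from t(2) that obtain f where "w = single f 1" by blast
    then show ?thesis
      by (auto simp: e lookup_scale lookup_single when_def single_one_eq_iff)
  qed
  then have "lookup (\<Sum>w\<in>t. single 0 (u w) * w) e = (\<Sum>w\<in>t. if w = v then u v else 0)"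
    by (simp add: lookup_sum)
  also have "\<dots> = u v"
    using t(1) v(1) by simp
  finally show False
    using t(3) v(2) by simp
qed

text \<open>The map \<open>\<psi>\<close> kills all multiples by polynomials without constant term: this is the lower bound of
  Nakayama's lemma, but valid for inhomogeneous generating sets as well.\<close>

lemma card_le_generators:
  fixes \<psi> :: "'b \<Rightarrow> 'k::field mpolynomial"
  assumes M: "module (poly_ring n) M" and T: "finite T" "generates (poly_ring n) M T"
    and add: "\<And>x y. x \<in> carrier M \<Longrightarrow> y \<in> carrier M \<Longrightarrow> \<psi> (x \<oplus>\<^bsub>M\<^esub> y) = \<psi> x + \<psi> y"
    and smult: "\<And>r x. r \<in> carrier (poly_ring n) \<Longrightarrow> x \<in> carrier M \<Longrightarrow>
      \<psi> (r \<odot>\<^bsub>M\<^esub> x) = single 0 (lookup r 0) * \<psi> x"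
    and E: "\<And>e. e \<in> E \<Longrightarrow> single e 1 \<in> \<psi> ` carrier M"
  shows "card E \<le> card T"
proof -
  interpret M: module "poly_ring n" M by fact
  define N where "N = {x \<in> carrier M. \<psi> x \<in> mpoly.span (\<psi> ` T)}"
  have T': "T \<subseteq> carrier M"
    using T(2) by (simp add: generates_def)
  have smult': "r \<odot>\<^bsub>M\<^esub> x \<in> N" if "r \<in> carrier (poly_ring n)" "x \<in> N" for r x
    using that smult mpoly.span_scale by (auto simp: N_def)
  have "submodule N (poly_ring n) M"
  \<comment> \<open>Zero and negatives are reached through the scalars 0 and -1, since \<psi> is
    only assumed to respect sums and scalar multiples.\<close>
  proof (rule M.submoduleI)
    have "\<psi> \<zero>\<^bsub>M\<^esub> = 0"
      using smult[of 0 "\<zero>\<^bsub>M\<^esub>"] by simp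
    then show "\<zero>\<^bsub>M\<^esub> \<in> N"
      by (simp add: N_def mpoly.span_zero)
    show "\<ominus>\<^bsub>M\<^esub> x \<in> N" if "x \<in> N" for x
    proof -
      have "\<ominus>\<^bsub>M\<^esub> x = (\<ominus>\<^bsub>poly_ring n\<^esub> \<one>\<^bsub>poly_ring n\<^esub>) \<odot>\<^bsub>M\<^esub> x"
        using M.smult_l_minus[OF M.R.one_closed, of x] M.smult_one[of x] that
        by (simp only: N_def mem_Collect_eq)
      with smult'[OF M.R.a_inv_closed[OF M.R.one_closed] that] show ?thesis
        by (simp only:)
    qed
    show "x \<oplus>\<^bsub>M\<^esub> y \<in> N" if "x \<in> N" "y \<in> N" for x y
      using that add mpoly.span_add by (auto simp: N_def)
  qed (use smult' in \<open>auto simp: N_def\<close>)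
  moreover have "T \<subseteq> N"
    using T' by (auto simp: N_def intro!: mpoly.span_base)
  ultimately have "N = carrier M"
    using T(2) by (simp add: generates_def)
  have "(\<lambda>e. single e (1 :: 'k)) ` E \<subseteq> mpoly.span (\<psi> ` T)"
  proof (intro image_subsetI)
    fix e assume "e \<in> E"
    with E obtain x where "x \<in> carrier M" "single e 1 = \<psi> x"
      by blast
    with \<open>N = carrier M\<close> show "single e 1 \<in> mpoly.span (\<psi> ` T)"
      unfolding N_def by auto
  qed
  then have "card ((\<lambda>e. single e (1 :: 'k)) ` E) \<le> card (\<psi> ` T)"
    using mpoly.independent_span_bound[OF _ independent_singles] T(1) by blast
  moreover have "inj_on (\<lambda>e. single e (1 :: 'k)) E"
    by (rule inj_onI) (simp add: single_one_eq_iff)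
  ultimately show ?thesis
    using card_image_le[OF T(1), of \<psi>] by (simp add: card_image)
qed

lemma single_in_submodule:
  assumes N: "\<And>r p. r \<in> carrier (poly_ring n) \<Longrightarrow> p \<in> N \<Longrightarrow> r * p \<in> N"
    and "single f 1 \<in> N" "f \<preceq> e" "e \<in> expos n"
  shows "single e (c :: 'k::field) \<in> N"
proof -
  obtain d where d: "e = f + d"
    using expo_le_addE[OF assms(3)] .
  with assms(4) have "single d c * single f 1 \<in> N"
    by (intro N assms) simp
  with d show ?thesis
    by (simp add: mult_single add.commute)
qed

text \<open>The minimal monomials generate because every exponent of A lies above a minimal one. No
  smaller set does, as seen by projecting to the coefficients at the minimal exponents.\<close>

lemma num_gens_mono_ideal:
  assumes A: "expo_ideal n A" and fin: "finite (min_expos A)"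
  shows "num_gens (poly_ring n :: 'k::field mpolynomial ring)
    (ideal_module (poly_ring n) (mono_ideal A)) = card (min_expos A)"
proof (rule num_gens_eqI)
  let ?R = "poly_ring n :: 'k mpolynomial ring"
  let ?M = "ideal_module ?R (mono_ideal A)"
  have M: "module ?R ?M"
    by (intro module_ideal_module cring_poly_ring ideal_mono_ideal A)
  have sub: "min_expos A \<subseteq> A"
    by (auto simp: min_expos_def)
  show "generates ?R ?M ((\<lambda>e. single e 1) ` min_expos A)"
    unfolding generates_def
  proof (intro conjI allI impI, goal_cases)
    case 1
    show ?case using sub by auto
  next
    case (2 N)
    then interpret N: submodule N ?R ?M by simp
    have mult: "r * p \<in> N" if "r \<in> carrier ?R" "p \<in> N" for r p
      using N.smult_closed[OF that] by simp
    have "mono_ideal A \<subseteq> N"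
    proof (rule mono_ideal_subsetI)
      show "0 \<in> N"
        using N.one_closed by simp
      show "p + q \<in> N" if "p \<in> N" "q \<in> N" for p q
        using N.m_closed[OF that] by simp
      fix e and c :: 'k assume e: "e \<in> A"
      have e': "e \<in> expos n"
        using e expo_ideal_subset[OF A] by (rule rev_subsetD)
      obtain f where f: "f \<in> min_expos A" "f \<preceq> e"
        using min_expo_below[OF expo_ideal_subset[OF A] e] .
      have "single f 1 \<in> N"
        using 2 f(1) by blast
      from single_in_submodule[OF mult this f(2) e'] show "single e c \<in> N" .
    qed
    with N.subset show ?case
      by simp
  qed
  show "card (min_expos A) \<le> card T" if "finite T" "generates ?R ?M T" for T
    using M that
  proof (rule card_le_generators[where \<psi> = "restr (min_expos A)"])
    show "single e 1 \<in> restr (min_expos A) ` carrier ?M" if "e \<in> min_expos A" for e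
      using that sub by (intro image_eqI[of _ _ "single e 1"]) (auto simp: restr_single)
  qed (auto simp: restr_add restr_min_expos_mult)
qed (rule fin)

text \<open>Minimal monomials in B become zero in the quotient, and the others still generate. The
  projection onto those others vanishes on the ideal of B, so it descends to cosets and yields the
  lower bound.\<close>

lemma num_gens_mono_ideal_quotient:
  assumes A: "expo_ideal n A" and B: "expo_ideal n B" "B \<subseteq> A" and fin: "finite (min_expos A)"
  shows "num_gens (poly_ring n :: 'k::field mpolynomial ring)
    (quotient_module (ideal_module (poly_ring n) (mono_ideal A)) (mono_ideal B)) = card (min_expos A - B)"
proof (rule num_gens_eqI)
  let ?R = "poly_ring n :: 'k mpolynomial ring"
  let ?J = "ideal_module ?R (mono_ideal A)"
  let ?K = "mono_ideal B :: 'k mpolynomial set"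
  let ?M = "quotient_module ?J ?K"
  let ?E = "min_expos A - B"
  have J: "module ?R ?J"
    by (intro module_ideal_module cring_poly_ring ideal_mono_ideal A)
  have K: "submodule ?K ?R ?J"
    using B by (intro submodule_ideal_module cring_poly_ring ideal_mono_ideal A) auto
  interpret J: module ?R ?J by (rule J)
  interpret K: abelian_subgroup ?K ?J by (rule abelian_subgroup_submodule[OF J K])
  interpret M: module ?R ?M by (rule module_quotient_module[OF J K])
  have sub: "min_expos A \<subseteq> A"
    by (auto simp: min_expos_def)
  have smult: "r \<odot>\<^bsub>?M\<^esub> (?K +>\<^bsub>?J\<^esub> p) = ?K +>\<^bsub>?J\<^esub> (r * p)"
    if "r \<in> carrier ?R" "p \<in> mono_ideal A" for r p
    using quotient_module_smult[OF J K that(1), of p] that(2) by simp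
  have add: "(?K +>\<^bsub>?J\<^esub> p) <+>\<^bsub>?J\<^esub> (?K +>\<^bsub>?J\<^esub> q) = ?K +>\<^bsub>?J\<^esub> (p + q)"
    if "p \<in> mono_ideal A" "q \<in> mono_ideal A" for p q
    using K.a_rcos_sum[of p q] that by simp
  have const: "?K +>\<^bsub>?J\<^esub> p = ?K" if "p \<in> ?K" for p
    using K.a_rcos_const[OF that] .
  have coset: "?K +>\<^bsub>?J\<^esub> p \<in> a_rcosets\<^bsub>?J\<^esub> ?K" if "p \<in> mono_ideal A" for p
    using J.a_rcosetsI[of ?K p] K.a_subset that by simp
  show "generates ?R ?M ((\<lambda>e. ?K +>\<^bsub>?J\<^esub> single e 1) ` ?E)"
    unfolding generates_def
  proof (intro conjI allI impI, goal_cases)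
    case 1
    show ?case using sub by (auto intro!: coset)
  next
    case (2 N)
    then interpret N: submodule N ?R ?M by simp
    \<comment> \<open>Generation is checked on the preimage of N, where single terms can be used. A
      minimal f in B lies in it because its coset is zero, any other because its coset is one of the
      generators.\<close>
    define N' where "N' = {p \<in> mono_ideal A. ?K +>\<^bsub>?J\<^esub> p \<in> N}"
    have KN: "?K \<in> N"
      using N.one_closed by simp
    have mult: "r * p \<in> N'" if "r \<in> carrier ?R" "p \<in> N'" for r p
    proof -
      have p: "p \<in> mono_ideal A" "?K +>\<^bsub>?J\<^esub> p \<in> N"
        using that(2) by (simp_all add: N'_def)
      have "r * p \<in> mono_ideal A"
        using J.smult_closed[OF that(1), of p] p(1) by simp
      with N.smult_closed[OF that(1) p(2)] smult[OF that(1) p(1)] show ?thesis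
        by (simp add: N'_def)
    qed
    have "mono_ideal A \<subseteq> N'"
    proof (rule mono_ideal_subsetI)
      show "0 \<in> N'"
        using KN by (simp add: N'_def const)
      show "p + q \<in> N'" if "p \<in> N'" "q \<in> N'" for p q
        using that N.m_closed[of "?K +>\<^bsub>?J\<^esub> p" "?K +>\<^bsub>?J\<^esub> q"] add[of p q]
        by (auto simp: N'_def)
      fix e and c :: 'k assume e: "e \<in> A"
      have e': "e \<in> expos n"
        using e expo_ideal_subset[OF A] by (rule rev_subsetD)
      obtain f where f: "f \<in> min_expos A" "f \<preceq> e"
        using min_expo_below[OF expo_ideal_subset[OF A] e] .
      have "single f 1 \<in> N'"
      proof (cases "f \<in> B")
        case True
        with f sub KN show ?thesis
          by (auto simp: N'_def const)
      next
        case False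
        with f sub 2 show ?thesis
          by (auto simp: N'_def)
      qed
      from single_in_submodule[OF mult this f(2) e'] show "single e c \<in> N'" .
    qed
    then have "?K +>\<^bsub>?J\<^esub> p \<in> N" if "p \<in> mono_ideal A" for p
      using that by (auto simp: N'_def)
    then have "a_rcosets\<^bsub>?J\<^esub> ?K \<subseteq> N"
      by (auto simp: A_RCOSETS_def')
    with N.subset show ?case
      by auto
  qed
  show "card ?E \<le> card T" if T: "finite T" "generates ?R ?M T" for T
  proof -
    \<comment> \<open>The projection is constant on a coset of \<open>?K\<close>, so the image of a
      coset is a singleton and \<open>the_elem\<close> reads off its value without choosing a
      representative.\<close>
    define \<psi> :: "'k mpolynomial set \<Rightarrow> 'k mpolynomial" where "\<psi> X = the_elem (restr ?E ` X)" for X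
    have restr_K: "restr ?E q = 0" if "q \<in> ?K" for q
      using that by (rule restr_eq_0) blast
    have \<psi>: "\<psi> (?K +>\<^bsub>?J\<^esub> p) = restr ?E p" for p
    proof -
      have "restr ?E ` (?K +>\<^bsub>?J\<^esub> p) = (\<lambda>q. restr ?E (q + p)) ` ?K"
        by (auto simp: a_r_coset_def')
      also have "\<dots> = (\<lambda>q. restr ?E p) ` ?K"
        by (intro image_cong refl) (simp add: restr_add restr_K)
      also have "\<dots> = {restr ?E p}"
        using mono_ideal_zero[of B] by blast
      finally show ?thesis
        by (simp add: \<psi>_def)
    qed
    have repr: "\<exists>p\<in>mono_ideal A. X = ?K +>\<^bsub>?J\<^esub> p" if "X \<in> carrier ?M" for X
      using that by (auto simp: A_RCOSETS_def')
    show ?thesis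
      using M.module_axioms T
    proof (rule card_le_generators[where \<psi> = \<psi>])
      fix X Y assume "X \<in> carrier ?M" "Y \<in> carrier ?M"
      then obtain p q where "p \<in> mono_ideal A" "X = ?K +>\<^bsub>?J\<^esub> p" "q \<in> mono_ideal A" "Y = ?K +>\<^bsub>?J\<^esub> q"
        using repr by meson
      then show "\<psi> (X \<oplus>\<^bsub>?M\<^esub> Y) = \<psi> X + \<psi> Y"
        by (simp add: add \<psi> restr_add)
    next
      fix r X assume r: "r \<in> carrier ?R" and "X \<in> carrier ?M"
      then obtain p where "p \<in> mono_ideal A" "X = ?K +>\<^bsub>?J\<^esub> p"
        using repr by meson
      then show "\<psi> (r \<odot>\<^bsub>?M\<^esub> X) = single 0 (lookup r 0) * \<psi> X"
        by (simp only: smult[OF r] \<psi>) (rule restr_min_expos_mult, auto)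
    next
      fix e assume "e \<in> ?E"
      with sub have "\<psi> (?K +>\<^bsub>?J\<^esub> single e 1) = single e 1" "?K +>\<^bsub>?J\<^esub> single e 1 \<in> carrier ?M"
        by (auto simp: \<psi> restr_single intro!: coset)
      then show "single e 1 \<in> \<psi> ` carrier ?M"
        by (metis imageI)
    qed
  qed
qed (use fin in simp)

section \<open>Symbolic powers of Stanley--Reisner ideals\<close>

text \<open>The exponents of the monomials in the prime of a face, in the Stanley--Reisner ideal, and in its
  symbolic powers, respectively.\<close>

definition off_face :: "nat \<Rightarrow> nat set \<Rightarrow> expo set" where
  "off_face n F = {e \<in> expos n. \<not> keys e \<subseteq> F}"

definition dependents :: "nat \<Rightarrow> nat set set \<Rightarrow> expo set" where
  "dependents n \<Delta> = {e \<in> expos n. keys e \<notin> \<Delta>}"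

definition symb :: "nat \<Rightarrow> nat set set \<Rightarrow> nat \<Rightarrow> expo set" where
  "symb n \<Delta> l = {e \<in> expos n. \<forall>F\<in>facets \<Delta>. l \<le> weight ({1..n} - F) e}"

lemma var_eq: "var i = single (single i 1) 1"
  by (simp add: var_def)

lemma single_expo_le_iff: "single i 1 \<preceq> e \<longleftrightarrow> i \<in> keys e"
  by (auto simp: expo_le_def in_keys_iff lookup_single when_def Suc_le_eq)

lemma expo_ideal_off_face: "expo_ideal n (off_face n F)"
  by (auto simp: expo_ideal_def off_face_def keys_add_expo)

lemma genideal_vars:
  "Idl\<^bsub>poly_ring n\<^esub> (var ` ({1..n} - F)) = (mono_ideal (off_face n F) :: 'k::field mpolynomial set)"
proof -
  have "var ` ({1..n} - F) = (\<lambda>e. single e (1 :: 'k)) ` ((\<lambda>i. single i 1) ` ({1..n} - F))"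
    by (simp add: image_image var_eq)
  moreover have "(\<lambda>i. single i 1) ` ({1..n} - F) \<subseteq> expos n"
    by (auto simp: expos_def)
  moreover have "up_set n ((\<lambda>i. single i 1) ` ({1..n} - F)) = off_face n F"
  proof -
    have "(\<exists>i\<in>{1..n} - F. i \<in> keys e) \<longleftrightarrow> \<not> keys e \<subseteq> F" if "e \<in> expos n" for e
      using that unfolding expos_def by blast
    then show ?thesis
      by (auto simp only: up_set_def off_face_def bex_simps single_expo_le_iff)
  qed
  ultimately show ?thesis
    using genideal_monomials[of "(\<lambda>i. single i 1) ` ({1..n} - F)" n, where 'k = 'k] by (simp only:)
qed

text \<open>A set is independent iff some basis contains it, so a monomial lies in all the primes
  P_F iff its support is dependent.\<close>

lemma stanley_reisner_mono_ideal:
  assumes M: "matroid n \<Delta>"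
  shows "stanley_reisner_ideal n \<Delta> = (mono_ideal (dependents n \<Delta>) :: 'k::field mpolynomial set)"
proof -
  have "keys e \<notin> \<Delta> \<longleftrightarrow> (\<forall>F\<in>facets \<Delta>. \<not> keys e \<subseteq> F)" for e :: expo
    using independent_subset_facet[OF M, of "keys e"] matroid_subset[OF M facet_independent, of _ "keys e"]
    by metis
  then have "(\<Inter>F\<in>facets \<Delta>. off_face n F) = dependents n \<Delta>"
    using facets_ne[OF M] by (auto simp: off_face_def dependents_def)
  then show ?thesis
    unfolding stanley_reisner_ideal_def genideal_vars by (simp add: mono_ideal_Inter facets_ne[OF M])
qed

lemma expo_ideal_dependents:
  assumes "matroid n \<Delta>"
  shows "expo_ideal n (dependents n \<Delta>)"
  unfolding expo_ideal_def dependents_def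
  using matroid_subset[OF assms] by (auto simp: keys_add_expo)

text \<open>Restricting to the monomials supported on \<open>F\<close> is the substitution \<open>x\<^sub>i = 0\<close> for \<open>i \<notin> F\<close>; its target has
  no zero divisors.\<close>

lemma primeideal_off_face:
  "primeideal (mono_ideal (off_face n F)) (poly_ring n :: 'k::field mpolynomial ring)"
proof (rule primeidealI)
  show "ideal (mono_ideal (off_face n F)) (poly_ring n :: 'k mpolynomial ring)"
    by (rule ideal_mono_ideal[OF expo_ideal_off_face])
  show "cring (poly_ring n :: 'k mpolynomial ring)"
    by (rule cring_poly_ring)
  have "0 \<notin> off_face n F"
    by (simp add: off_face_def)
  then show "carrier (poly_ring n :: 'k mpolynomial ring) \<noteq> mono_ideal (off_face n F)"
    by (metis carrier_poly_ring mono_ideal_eq_iff zero_in_expos)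
  define G where "G = {e :: expo. keys e \<subseteq> F}"
  fix p q :: "'k mpolynomial"
  assume carr: "p \<in> carrier (poly_ring n)" "q \<in> carrier (poly_ring n)"
    and pq: "p \<otimes>\<^bsub>poly_ring n\<^esub> q \<in> mono_ideal (off_face n F)"
  have restr_mult: "restr G (a * b) = 0" if "a \<in> mono_ideal (- G)" for a b :: "'k mpolynomial"
  proof (rule restr_eq_0)
    show "a * b \<in> mono_ideal (expo_sum (- G) UNIV)"
      using that by (rule mono_ideal_mult) (simp add: mono_ideal_def)
    show "expo_sum (- G) UNIV \<inter> G = {}"
      by (auto simp: expo_sum_def G_def keys_add_expo)
  qed
  have diff: "a - restr G a \<in> mono_ideal (- G)" for a :: "'k mpolynomial"
    by (auto simp: mono_ideal_def in_keys_iff lookup_minus lookup_restr split: if_splits)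
  \<comment> \<open>The last two summands have a factor whose monomials all leave F. This property
    survives multiplication, so the projection kills them and is multiplicative.\<close>
  have "p * q = restr G p * restr G q + (p - restr G p) * q + (q - restr G q) * restr G p"
    by (simp add: algebra_simps)
  then have "restr G (p * q) = restr G (restr G p * restr G q)"
    by (simp add: restr_add restr_mult[OF diff])
  also have "\<dots> = restr G p * restr G q"
  proof -
    have in_G: "restr G a \<in> mono_ideal G" for a :: "'k mpolynomial"
      by (auto simp: mono_ideal_def in_keys_iff lookup_restr split: if_splits)
    have "expo_sum G G \<subseteq> G"
      by (auto simp: expo_sum_def G_def keys_add_expo)
    with mono_ideal_mult[OF in_G in_G, of p q] have "restr G p * restr G q \<in> mono_ideal G"
      using mono_ideal_mono by blast
    then show ?thesis
      by (intro poly_mapping_eqI) (auto simp: lookup_restr mono_ideal_def in_keys_iff)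
  qed
  finally have eq: "restr G (p * q) = restr G p * restr G q" .
  have "restr G (p * q) = 0"
    using pq by (intro restr_eq_0[of _ "off_face n F"]) (auto simp: off_face_def G_def)
  \<comment> \<open>Polynomials over a field have no zero divisors.\<close>
  with eq have "restr G p = 0 \<or> restr G q = 0"
    by simp
  moreover have "a \<in> mono_ideal (off_face n F)"
    if "restr G a = 0" "a \<in> mono_ideal (expos n)" for a :: "'k mpolynomial"
  proof -
    have "e \<in> off_face n F" if "e \<in> keys a" for e
    proof -
      have "e \<notin> G"
        using arg_cong[OF \<open>restr G a = 0\<close>, of "\<lambda>b. lookup b e"] that
        by (auto simp: lookup_restr in_keys_iff split: if_splits)
      with \<open>a \<in> mono_ideal (expos n)\<close> that show ?thesis
        by (auto simp: off_face_def G_def mono_ideal_def)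
    qed
    then show ?thesis
      by (auto simp: mono_ideal_def)
  qed
  ultimately show "p \<in> mono_ideal (off_face n F) \<or> q \<in> mono_ideal (off_face n F)"
    using carr by auto
qed

text \<open>A monomial of weight at least l + 1 contains a variable outside F; splitting it off
  costs exactly one unit of weight. Conversely every monomial of P_F has weight at least
  one.\<close>

lemma ideal_power_off_face:
  "ideal_power (poly_ring n) (mono_ideal (off_face n F)) l =
    (mono_ideal {e \<in> expos n. l \<le> weight ({1..n} - F) e} :: 'k::field mpolynomial set)"
proof (rule ideal_power_mono_ideal(2)[OF expo_ideal_off_face])
  fix l
  show "{e \<in> expos n. Suc l \<le> weight ({1..n} - F) e} =
    expo_sum {e \<in> expos n. l \<le> weight ({1..n} - F) e} (off_face n F)" (is "?L = ?R")
  proof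
    show "?L \<subseteq> ?R"
    proof
      fix e assume "e \<in> ?L"
      then have e: "e \<in> expos n" "Suc l \<le> weight ({1..n} - F) e"
        by auto
      have "\<exists>i\<in>{1..n} - F. lookup e i \<noteq> 0"
      proof (rule ccontr)
        assume "\<not> ?thesis"
        then have "weight ({1..n} - F) e = 0"
          unfolding weight_def by (intro sum.neutral) blast
        with e show False by simp
      qed
      then obtain i where i: "i \<in> {1..n}" "i \<notin> F" "i \<in> keys e"
        by (auto simp: in_keys_iff)
      then have "single i 1 \<preceq> e"
        by (simp only: single_expo_le_iff)
      then obtain d where d: "e = single i 1 + d"
        by (rule expo_le_addE)
      have "d \<in> {e \<in> expos n. l \<le> weight ({1..n} - F) e}"
        using e i by (simp add: d weight_single)
      moreover have "single i 1 \<in> off_face n F"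
        using i by (simp add: off_face_def expos_def)
      moreover have "e = d + single i 1"
        using d by (simp add: add.commute)
      ultimately show "e \<in> ?R"
        unfolding expo_sum_def by blast
    qed
    show "?R \<subseteq> ?L"
    proof
      fix e assume "e \<in> ?R"
      then obtain a b where ab: "a \<in> expos n" "l \<le> weight ({1..n} - F) a" "b \<in> off_face n F" "e = a + b"
        by (auto simp: expo_sum_def)
      then obtain i where i: "i \<in> {1..n}" "i \<notin> F" "i \<in> keys b"
        unfolding off_face_def expos_def by blast
      have "weight ({1..n} - F) (single i 1) \<le> weight ({1..n} - F) b"
        using i by (intro weight_mono) (simp only: single_expo_le_iff)
      with i ab show "e \<in> ?L"
        by (simp add: weight_single off_face_def)
    qed
  qed
qed auto

section \<open>Associated primes of the Stanley--Reisner ideal\<close>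

text \<open>If a lies in J but not in P, then for x in the remaining ideals the product a x lies in
  all of them, hence in P, and so does x. Intersecting with the carrier gives the empty family its
  meaning as the whole ring, which a prime cannot contain.\<close>

lemma prime_contains_finite_Inter:
  assumes "primeideal P R" "finite \<J>" "\<And>J. J \<in> \<J> \<Longrightarrow> ideal J R" "carrier R \<inter> \<Inter>\<J> \<subseteq> P"
  obtains J where "J \<in> \<J>" "J \<subseteq> P"
proof -
  interpret primeideal P R by fact
  have "\<exists>J\<in>\<J>. J \<subseteq> P"
    using assms(2-4)
  proof (induction \<J> rule: finite_induct)
    case empty
    then show ?case
      using I_notcarr a_subset by auto
  next
    case (insert J \<J>)
    show ?case
    proof (cases "J \<subseteq> P")
      case False
      then obtain a where a: "a \<in> J" "a \<notin> P" by blast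
      have ideals: "ideal K R" if "K \<in> insert J \<J>" for K
        using insert.prems(1) that by blast
      have "a \<in> carrier R"
        using ideal.Icarr[OF ideals a(1)] by simp
      have "carrier R \<inter> \<Inter>\<J> \<subseteq> P"
      proof
        fix x assume x: "x \<in> carrier R \<inter> \<Inter>\<J>"
        have "a \<otimes>\<^bsub>R\<^esub> x \<in> K" if "K \<in> insert J \<J>" for K
          using that ideal.I_r_closed[OF ideals, of J a x] ideal.I_l_closed[OF ideals, of K x a] a x
            \<open>a \<in> carrier R\<close> by auto
        then have "a \<otimes>\<^bsub>R\<^esub> x \<in> P"
          using insert.prems(2) x \<open>a \<in> carrier R\<close> by blast
        with I_prime[of a x] a x \<open>a \<in> carrier R\<close> show "x \<in> P"
          by blast
      qed
      with insert.IH ideals show ?thesis by blast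
    qed blast
  qed
  with that show ?thesis by blast
qed

text \<open>The annihilator of the class of m in R/I is the colon ideal (I : m).\<close>

lemma annihilator_quotient:
  assumes "cring R" "ideal I R" "m \<in> carrier R"
  shows "{r \<in> carrier R. r \<odot>\<^bsub>quotient_module (ideal_module R (carrier R)) I\<^esub> (I +>\<^bsub>ideal_module R (carrier R)\<^esub> m) =
      \<zero>\<^bsub>quotient_module (ideal_module R (carrier R)) I\<^esub>} = {r \<in> carrier R. r \<otimes>\<^bsub>R\<^esub> m \<in> I}"
proof (rule Collect_cong, rule conj_cong[OF refl])
  let ?M = "ideal_module R (carrier R)"
  interpret cring R by fact
  interpret I: ideal I R by fact
  have M: "module R ?M" and S: "submodule I R ?M"
    using assms(1,2) oneideal I.a_subset by (auto intro: module_ideal_module submodule_ideal_module)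
  interpret M: module R ?M by fact
  interpret S: abelian_subgroup I ?M by (rule abelian_subgroup_submodule[OF M S])
  fix r assume r: "r \<in> carrier R"
  have "I +>\<^bsub>?M\<^esub> (r \<otimes>\<^bsub>R\<^esub> m) = I \<longleftrightarrow> r \<otimes>\<^bsub>R\<^esub> m \<in> I"
    using S.a_rcos_const M.a_coset_join1[OF _ _ S.a_subgroup, of "r \<otimes>\<^bsub>R\<^esub> m"] r assms(3) by auto
  with quotient_module_smult[OF M S r, of m] assms(3)
  show "r \<odot>\<^bsub>quotient_module ?M I\<^esub> (I +>\<^bsub>?M\<^esub> m) = \<zero>\<^bsub>quotient_module ?M I\<^esub> \<longleftrightarrow> r \<otimes>\<^bsub>R\<^esub> m \<in> I"
    by simp
qed

lemma ass_primes_ideal: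
  assumes "cring R" "ideal I R"
  shows "ass_primes R (quotient_module (ideal_module R (carrier R)) I) =
    {P. primeideal P R \<and> (\<exists>m\<in>carrier R. P = {r \<in> carrier R. r \<otimes>\<^bsub>R\<^esub> m \<in> I})}"
proof -
  have "carrier (quotient_module (ideal_module R (carrier R)) I) =
      (\<lambda>m. I +>\<^bsub>ideal_module R (carrier R)\<^esub> m) ` carrier R"
    by (auto simp: A_RCOSETS_def')
  then show ?thesis
    unfolding ass_primes_def by (simp only: bex_simps annihilator_quotient[OF assms] cong: bex_cong)
qed

text \<open>A prime of the form (I : m) contains the intersection of those P_F that miss m, hence
  one of them, and is contained in that one because P_F is prime. Conversely each P_F is the colon
  ideal of a suitable monomial.\<close>

lemma ass_primes_stanley_reisner:
  assumes M: "matroid n \<Delta>"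
  shows "ass_primes (poly_ring n)
      (quotient_module (ideal_module (poly_ring n) (carrier (poly_ring n))) (stanley_reisner_ideal n \<Delta>)) =
    (\<lambda>F. mono_ideal (off_face n F) :: 'k::field mpolynomial set) ` facets \<Delta>"
proof -
  let ?R = "poly_ring n :: 'k mpolynomial ring"
  let ?I = "stanley_reisner_ideal n \<Delta> :: 'k mpolynomial set"
  let ?P = "\<lambda>F. mono_ideal (off_face n F) :: 'k mpolynomial set"
  interpret R: cring ?R by (rule cring_poly_ring)
  have I: "ideal ?I ?R"
    unfolding stanley_reisner_mono_ideal[OF M] by (intro ideal_mono_ideal expo_ideal_dependents M)
  have memI: "p \<in> ?I \<longleftrightarrow> (\<forall>F\<in>facets \<Delta>. p \<in> ?P F)" for p
    unfolding stanley_reisner_ideal_def genideal_vars by (rule INT_iff)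
  have prime: "primeideal (?P F) ?R" for F
    by (rule primeideal_off_face)
  have "primeideal P ?R \<and> (\<exists>m\<in>carrier ?R. P = {r \<in> carrier ?R. r * m \<in> ?I}) \<longleftrightarrow> (\<exists>F\<in>facets \<Delta>. P = ?P F)"
    (is "?L \<longleftrightarrow> ?Rhs") for P
  proof
    assume ?L
    then obtain m where P: "primeideal P ?R" "m \<in> carrier ?R" "P = {r \<in> carrier ?R. r * m \<in> ?I}"
      by blast
    \<comment> \<open>Primes that contain m put no condition on r in r * m.\<close>
    define \<J> where "\<J> = ?P ` {F \<in> facets \<Delta>. m \<notin> ?P F}"
    have "r \<in> P" if r: "r \<in> carrier ?R" "r \<in> \<Inter>\<J>" for r
    proof -
      have "r * m \<in> ?P F" if F: "F \<in> facets \<Delta>" for F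
      proof (cases "m \<in> ?P F")
        case True
        then show ?thesis
          using ideal.I_l_closed[OF primeideal.axioms(1)[OF prime] True r(1)] by simp
      next
        case False
        with F r(2) have "r \<in> ?P F"
          by (auto simp: \<J>_def)
        from ideal.I_r_closed[OF primeideal.axioms(1)[OF prime] this P(2)] show ?thesis
          by simp
      qed
      with r(1) show ?thesis
        by (simp add: P(3) memI)
    qed
    then have "carrier ?R \<inter> \<Inter>\<J> \<subseteq> P"
      by blast
    moreover have "finite \<J>"
      using finite_facets[OF M] by (simp add: \<J>_def)
    moreover have "ideal J ?R" if "J \<in> \<J>" for J
      using that primeideal.axioms(1)[OF prime] by (auto simp: \<J>_def)
    ultimately obtain J where "J \<in> \<J>" "J \<subseteq> P"
      using prime_contains_finite_Inter[OF P(1)] by metis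
    then obtain F where F: "F \<in> facets \<Delta>" "m \<notin> ?P F" "?P F \<subseteq> P"
      unfolding \<J>_def by blast
    have "P \<subseteq> ?P F"
    proof
      fix r assume "r \<in> P"
      then have "r \<in> carrier ?R" "r * m \<in> ?P F"
        using F(1) by (auto simp: P(3) memI)
      with primeideal.I_prime[OF prime _ P(2), of r F] F(2) show "r \<in> ?P F"
        by simp
    qed
    with F show ?Rhs by blast
  next
    assume ?Rhs
    then obtain F where F: "F \<in> facets \<Delta>" "P = ?P F" by blast
    have finF: "finite F"
      using matroid_finite[OF M facet_independent[OF F(1)]] .
    \<comment> \<open>The product of the variables in F lies outside P_F, but in P_G for every other
      basis G, since F is not contained in G.\<close>
    define m :: "'k mpolynomial" where "m = single (ind F) 1"
    have ind: "ind F \<in> expos n"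
      using facet_subset[OF M F(1)] finF by (simp add: expos_def)
    then have m: "m \<in> carrier ?R"
      by (simp add: m_def)
    have in_P: "m \<in> ?P G \<longleftrightarrow> G \<noteq> F" if "G \<in> facets \<Delta>" for G
      using facet_subset_eq[OF F(1) that] ind finF by (auto simp: m_def off_face_def)
    have "r * m \<in> ?I \<longleftrightarrow> r \<in> ?P F" if r: "r \<in> carrier ?R" for r
    proof
      assume "r * m \<in> ?I"
      then have "r * m \<in> ?P F"
        using F(1) by (simp add: memI)
      with primeideal.I_prime[OF prime r m, of F] in_P[OF F(1)] show "r \<in> ?P F"
        by simp
    next
      assume rF: "r \<in> ?P F"
      have "r * m \<in> ?P G" if G: "G \<in> facets \<Delta>" for G
      proof (cases "G = F")
        case True
        then show ?thesis
          using ideal.I_r_closed[OF primeideal.axioms(1)[OF prime] rF m] by simp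
      next
        case False
        with in_P[OF G] have "m \<in> ?P G" by simp
        from ideal.I_l_closed[OF primeideal.axioms(1)[OF prime] this r] show ?thesis
          by simp
      qed
      then show "r * m \<in> ?I"
        by (simp add: memI)
    qed
    moreover have "?P F \<subseteq> carrier ?R"
      by (auto simp: off_face_def mono_ideal_def)
    ultimately have "P = {r \<in> carrier ?R. r * m \<in> ?I}"
      unfolding F(2) by blast
    with m prime F(2) show ?L by blast
  qed
  then show ?thesis
    unfolding ass_primes_ideal[OF cring_poly_ring I] by auto
qed

lemma symbolic_power_stanley_reisner:
  assumes M: "matroid n \<Delta>"
  shows "symbolic_power (poly_ring n) (stanley_reisner_ideal n \<Delta>) l =
    (mono_ideal (symb n \<Delta> l) :: 'k::field mpolynomial set)"
proof -
  have "(\<Inter>F\<in>facets \<Delta>. {e \<in> expos n. l \<le> weight ({1..n} - F) e}) = symb n \<Delta> l"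
    using facets_ne[OF M] by (auto simp: symb_def)
  moreover have "(mono_ideal (symb n \<Delta> l) :: 'k mpolynomial set) \<subseteq> mono_ideal (expos n)"
    by (auto simp: symb_def)
  ultimately show ?thesis
    unfolding symbolic_power_def ass_primes_stanley_reisner[OF M] image_image INF_image comp_def
      ideal_power_off_face mono_ideal_Inter[OF facets_ne[OF M]]
    by (simp add: Int_absorb1)
qed

section \<open>Products of circuits\<close>

definition cprod :: "nat set multiset \<Rightarrow> expo" where
  "cprod M = (\<Sum>C\<in>#M. ind C)"

lemma cprod_simps [simp]: "cprod {#} = 0" "cprod (add_mset C M) = ind C + cprod M"
  by (simp_all add: cprod_def)

lemma lookup_cprod_replicate:
  "finite C \<Longrightarrow> lookup (cprod (replicate_mset l C)) i = (if i \<in> C then l else 0)"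
  by (induction l) (simp_all add: lookup_add lookup_ind)

lemma keys_cprod: "(\<And>C. C \<in># M \<Longrightarrow> finite C) \<Longrightarrow> keys (cprod M) = \<Union>(set_mset M)"
  by (induction M) (simp_all add: keys_add_expo)

lemma weight_cprod: "weight W (cprod M) = (\<Sum>C\<in>#M. weight W (ind C))"
  by (induction M) simp_all

lemma weight_ind_circuit:
  assumes "C \<in> circuits n \<Delta>"
  shows "weight ({1..n} - F) (ind C) = card (C - F)"
proof -
  have "C \<inter> ({1..n} - F) = C - F"
    using assms by (auto simp: circuits_def)
  then show ?thesis
    using circuit_finite[OF assms] by (simp add: weight_ind)
qed

text \<open>The exponents of the ordinary power I^l. The factors form a multiset because circuits
  may repeat.\<close>

definition circuit_prods :: "nat \<Rightarrow> nat set set \<Rightarrow> nat \<Rightarrow> expo set" where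
  "circuit_prods n \<Delta> l =
     {e \<in> expos n. \<exists>M. size M = l \<and> set_mset M \<subseteq> circuits n \<Delta> \<and> cprod M \<preceq> e}"

lemma ind_circuit_expos: "C \<in> circuits n \<Delta> \<Longrightarrow> ind C \<in> expos n"
  using circuit_finite[of C n \<Delta>] by (simp add: expos_def circuits_def)

lemma cprod_expos: "set_mset M \<subseteq> circuits n \<Delta> \<Longrightarrow> cprod M \<in> expos n"
  by (induction M) (auto intro: ind_circuit_expos)

lemma cprod_circuit_prods: "set_mset M \<subseteq> circuits n \<Delta> \<Longrightarrow> cprod M \<in> circuit_prods n \<Delta> (size M)"
  using cprod_expos[of M n \<Delta>] expo_le_refl unfolding circuit_prods_def by blast

lemma dependent_above_circuit:
  assumes "e \<in> dependents n \<Delta>"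
  obtains C where "C \<in> circuits n \<Delta>" "ind C \<preceq> e"
proof -
  have "keys e \<subseteq> {1..n}" "keys e \<notin> \<Delta>"
    using assms by (simp_all add: dependents_def expos_def)
  then obtain C where "C \<in> circuits n \<Delta>" "C \<subseteq> keys e"
    using dependent_contains_circuit by metis
  with that circuit_finite[of C n \<Delta>] show ?thesis
    by (simp add: ind_le_iff)
qed

lemma ind_circuit_dependents: "C \<in> circuits n \<Delta> \<Longrightarrow> ind C \<in> dependents n \<Delta>"
  using ind_circuit_expos[of C n \<Delta>] circuit_finite[of C n \<Delta>] by (simp add: dependents_def circuits_def)

lemma circuit_prods_Suc:
  "circuit_prods n \<Delta> (Suc l) = expo_sum (circuit_prods n \<Delta> l) (dependents n \<Delta>)"
proof
  show "circuit_prods n \<Delta> (Suc l) \<subseteq> expo_sum (circuit_prods n \<Delta> l) (dependents n \<Delta>)"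
  proof
    fix e assume "e \<in> circuit_prods n \<Delta> (Suc l)"
    then obtain M where e: "e \<in> expos n"
      and M: "size M = Suc l" "set_mset M \<subseteq> circuits n \<Delta>" "cprod M \<preceq> e"
      by (auto simp: circuit_prods_def)
    from M(1) obtain C M' where M': "M = add_mset C M'"
      by (auto simp: size_eq_Suc_imp_eq_union dest!: size_eq_Suc_imp_eq_union)
    obtain d where d: "e = cprod M + d"
      using expo_le_addE[OF M(3)] .
    have "cprod M' \<preceq> cprod M' + d"
      by simp
    \<comment> \<open>The cofactor d is attached to the first l factors, leaving exactly the
      monomial of C for the last one.\<close>
    then have "cprod M' + d \<in> circuit_prods n \<Delta> l"
      using M e d unfolding circuit_prods_def M' by auto
    moreover have "ind C \<in> dependents n \<Delta>"
      using M(2) by (intro ind_circuit_dependents) (simp add: M')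
    moreover have "e = (cprod M' + d) + ind C"
      by (simp add: d M' ac_simps)
    ultimately show "e \<in> expo_sum (circuit_prods n \<Delta> l) (dependents n \<Delta>)"
      unfolding expo_sum_def by blast
  qed
  show "expo_sum (circuit_prods n \<Delta> l) (dependents n \<Delta>) \<subseteq> circuit_prods n \<Delta> (Suc l)"
  proof
    fix e assume "e \<in> expo_sum (circuit_prods n \<Delta> l) (dependents n \<Delta>)"
    then obtain a b where ab: "e = a + b" "a \<in> circuit_prods n \<Delta> l" "b \<in> dependents n \<Delta>"
      unfolding expo_sum_def by blast
    from ab(2) obtain M where M: "size M = l" "set_mset M \<subseteq> circuits n \<Delta>" "cprod M \<preceq> a" "a \<in> expos n"
      unfolding circuit_prods_def by blast
    obtain C where C: "C \<in> circuits n \<Delta>" "ind C \<preceq> b"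
      using dependent_above_circuit[OF ab(3)] .
    have "cprod (add_mset C M) \<preceq> e"
      using expo_le_add_mono[OF C(2) M(3)] by (simp add: ab(1) add.commute)
    moreover have "e \<in> expos n"
      using ab M by (simp add: dependents_def)
    moreover have "size (add_mset C M) = Suc l" "set_mset (add_mset C M) \<subseteq> circuits n \<Delta>"
      using M C by simp_all
    ultimately show "e \<in> circuit_prods n \<Delta> (Suc l)"
      unfolding circuit_prods_def by blast
  qed
qed

lemma circuit_prods_0: "circuit_prods n \<Delta> 0 = expos n"
  by (auto simp: circuit_prods_def expo_le_def)

lemma ideal_power_stanley_reisner:
  assumes M: "matroid n \<Delta>"
  shows "expo_ideal n (circuit_prods n \<Delta> l)"
    and "ideal_power (poly_ring n) (stanley_reisner_ideal n \<Delta>) l =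
      (mono_ideal (circuit_prods n \<Delta> l) :: 'k::field mpolynomial set)"
  unfolding stanley_reisner_mono_ideal[OF M]
  by (rule ideal_power_mono_ideal[OF expo_ideal_dependents[OF M] circuit_prods_0 circuit_prods_Suc])+

lemma expo_ideal_symb: "expo_ideal n (symb n \<Delta> l)"
  by (auto simp: expo_ideal_def symb_def intro: trans_le_add1)

text \<open>No basis contains a circuit, so each factor contributes at least one to the
  weight.\<close>

lemma cprod_symb:
  assumes M: "matroid n \<Delta>" and C: "set_mset M \<subseteq> circuits n \<Delta>"
  shows "cprod M \<in> symb n \<Delta> (size M)"
  unfolding symb_def
proof (intro CollectI conjI ballI cprod_expos[OF C])
  fix F assume F: "F \<in> facets \<Delta>"
  show "size M \<le> weight ({1..n} - F) (cprod M)"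
    using C
  proof (induction M)
    case (add C M)
    have C: "C \<in> circuits n \<Delta>"
      using add.prems by simp
    with add card_circuit_diff_pos[OF M C facet_independent[OF F]] show ?case
      by (simp add: weight_ind_circuit[OF C] del: One_nat_def)
  qed simp
qed

lemma circuit_prods_subset_symb:
  assumes "matroid n \<Delta>"
  shows "circuit_prods n \<Delta> l \<subseteq> symb n \<Delta> l"
proof
  fix e assume "e \<in> circuit_prods n \<Delta> l"
  then obtain M where "e \<in> expos n" "size M = l" "set_mset M \<subseteq> circuits n \<Delta>" "cprod M \<preceq> e"
    by (auto simp: circuit_prods_def)
  with cprod_symb[OF assms, of M] show "e \<in> symb n \<Delta> l"
    using expo_ideal_up[OF expo_ideal_symb] by blast
qed

section \<open>Minimal generators of the symbolic powers\<close>

lemma weight_strict_mono: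
  assumes "finite W" "e \<preceq> f" "i \<in> W" "lookup e i < lookup f i"
  shows "weight W e < weight W f"
  unfolding weight_def
  using assms by (intro sum_strict_mono_ex1) (auto simp: expo_le_def)

lemma expo_less_lookup:
  assumes "e \<preceq> f" "e \<noteq> f"
  obtains i where "lookup e i < lookup f i"
proof -
  from assms(2) obtain i where "lookup e i \<noteq> lookup f i"
    using poly_mapping_eqI[of e f] by blast
  with assms(1) that[of i] show ?thesis
    by (simp add: expo_le_def le_neq_implies_less)
qed

text \<open>A tight inequality at a basis avoiding i means that lowering the exponent of x_i leaves
  the symbolic power. A proper divisor lowers some exponent.\<close>

lemma min_expos_symbI:
  assumes "e \<in> symb n \<Delta> l"
    and "\<And>i. i \<in> keys e \<Longrightarrow> \<exists>F\<in>facets \<Delta>. i \<notin> F \<and> weight ({1..n} - F) e \<le> l"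
  shows "e \<in> min_expos (symb n \<Delta> l)"
  unfolding min_expos_def
proof (intro CollectI conjI ballI impI assms(1))
  fix f assume f: "f \<in> symb n \<Delta> l" "f \<preceq> e"
  show "f = e"
  proof (rule ccontr)
    assume "f \<noteq> e"
    then obtain i where i: "lookup f i < lookup e i"
      using expo_less_lookup[OF f(2)] by blast
    then have key: "i \<in> keys e"
      by (simp add: in_keys_iff)
    with assms(2) obtain F where F: "F \<in> facets \<Delta>" "i \<notin> F" "weight ({1..n} - F) e \<le> l"
      by blast
    have "i \<in> {1..n}"
      using key assms(1) by (auto simp: symb_def expos_def)
    with F(2) have "weight ({1..n} - F) f < weight ({1..n} - F) e"
      by (intro weight_strict_mono[OF _ f(2) _ i]) auto
    with F f(1) show False
      by (auto simp: symb_def)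
  qed
qed

text \<open>The exponents of a minimal generator are at most l. If x_i had a larger one, dividing by
  x_i would change nothing at bases containing i, and at the others the remaining power of x_i would
  already have weight l.\<close>

lemma finite_min_expos_symb: "finite (min_expos (symb n \<Delta> l))"
proof (rule finite_subset)
  show "min_expos (symb n \<Delta> l) \<subseteq>
    lookup -` {f. \<forall>x. (x \<in> {1..n} \<longrightarrow> f x \<in> {..l}) \<and> (x \<notin> {1..n} \<longrightarrow> f x = 0)}"
  proof (intro subsetI vimageI2 CollectI allI conjI impI)
    fix e i assume e: "e \<in> min_expos (symb n \<Delta> l)"
    then have e': "e \<in> symb n \<Delta> l" "e \<in> expos n"
      by (auto simp: min_expos_def symb_def)
    show "lookup e i = 0" if "i \<notin> {1..n}"
    proof -
      have "i \<notin> keys e"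
        using e'(2) that unfolding expos_def by blast
      then show ?thesis
        by (simp add: in_keys_iff)
    qed
    show "lookup e i \<in> {..l}" if i: "i \<in> {1..n}"
    proof (rule ccontr)
      assume "\<not> ?thesis"
      then have big: "l < lookup e i"
        by simp
      then have "single i 1 \<preceq> e"
        by (simp only: single_expo_le_iff in_keys_iff)
      then obtain d where d: "e = single i 1 + d"
        by (rule expo_le_addE)
      have "l \<le> weight ({1..n} - F) d" if F: "F \<in> facets \<Delta>" for F
      proof (cases "i \<in> F")
        case True
        have "l \<le> weight ({1..n} - F) e"
          using e'(1) F by (simp add: symb_def)
        with True show ?thesis
          by (simp add: d weight_single)
      next
        case False
        have "lookup d i \<le> weight ({1..n} - F) d"
          unfolding weight_def using i False by (intro member_le_sum) auto
        with big show ?thesis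
          by (simp add: d lookup_add)
      qed
      then have "d \<in> symb n \<Delta> l"
        using e'(2) by (simp add: symb_def d)
      moreover have "d \<preceq> e"
        by (simp add: d)
      ultimately have "d = e"
        using e by (simp add: min_expos_def)
      then have "single i 1 = (0 :: expo)"
        by (simp add: d)
      then show False
        by (metis keys_single keys_zero insert_not_empty one_neq_zero)
    qed
  qed
  have "inj (lookup :: expo \<Rightarrow> nat \<Rightarrow> nat)"
    by (rule injI) (simp only: poly_mapping.lookup_inject)
  moreover have "finite {f. \<forall>x. (x \<in> {1..n} \<longrightarrow> f x \<in> {..l}) \<and> (x \<notin> {1..n} \<longrightarrow> f x = 0)}"
    by (rule finite_set_of_finite_funs) auto
  ultimately show "finite ((lookup :: expo \<Rightarrow> _) -` {f. \<forall>x. (x \<in> {1..n} \<longrightarrow> f x \<in> {..l}) \<and> (x \<notin> {1..n} \<longrightarrow> f x = 0)})"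
    by (intro finite_vimageI)
qed

definition pure_powers :: "nat \<Rightarrow> nat set set \<Rightarrow> nat \<Rightarrow> expo set" where
  "pure_powers n \<Delta> l = (\<lambda>C. cprod (replicate_mset l C)) ` circuits n \<Delta>"

text \<open>For a positive power the support recovers the circuit; for l = 0 all powers would be
  1.\<close>

lemma card_pure_powers:
  assumes "1 \<le> l"
  shows "card (pure_powers n \<Delta> l) = card (circuits n \<Delta>)"
  unfolding pure_powers_def
proof (intro card_image inj_onI)
  fix C D assume C: "C \<in> circuits n \<Delta>" "D \<in> circuits n \<Delta>"
    and eq: "cprod (replicate_mset l C) = cprod (replicate_mset l D)"
  have "keys (cprod (replicate_mset l B)) = B" if "B \<in> circuits n \<Delta>" for B
    using circuit_finite[OF that] assms by (subst keys_cprod) (auto split: if_splits)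
  with C eq show "C = D"
    by metis
qed

text \<open>For i in C, a basis that omits only i from C gives x_C^l the weight l exactly.\<close>

lemma pure_powers_subset:
  assumes M: "matroid n \<Delta>"
  shows "pure_powers n \<Delta> l \<subseteq> min_expos (symb n \<Delta> l) \<inter> circuit_prods n \<Delta> l"
proof
  fix e assume "e \<in> pure_powers n \<Delta> l"
  then obtain C where C: "C \<in> circuits n \<Delta>" and e: "e = cprod (replicate_mset l C)"
    by (auto simp: pure_powers_def)
  have sub: "set_mset (replicate_mset l C) \<subseteq> circuits n \<Delta>"
    using C by auto
  have "e \<in> min_expos (symb n \<Delta> l)"
  proof (rule min_expos_symbI)
    show "e \<in> symb n \<Delta> l"
      using cprod_symb[OF M sub] by (simp add: e)
    fix i assume "i \<in> keys e"
    then have "i \<in> C"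
      using circuit_finite[OF C] by (simp add: e in_keys_iff lookup_cprod_replicate split: if_splits)
    then obtain F where F: "F \<in> facets \<Delta>" "C - F = {i}"
      using facet_meets_circuit_except[OF M C] by blast
    then have "weight ({1..n} - F) e = l"
      by (simp add: e weight_cprod weight_ind_circuit[OF C] del: One_nat_def)
    with F show "\<exists>F\<in>facets \<Delta>. i \<notin> F \<and> weight ({1..n} - F) e \<le> l"
      by blast
  qed
  moreover have "e \<in> circuit_prods n \<Delta> l"
    using cprod_circuit_prods[OF sub] by (simp add: e)
  ultimately show "e \<in> min_expos (symb n \<Delta> l) \<inter> circuit_prods n \<Delta> l"
    by blast
qed

text \<open>Dividing by x_e stays in the symbolic power. Bases containing e do not see the division;
  at the others the weight is at least 3 from C1 and C2 plus one for each remaining factor, so one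
  unit can be spared.\<close>

lemma mixed_product_not_minimal:
  assumes M: "matroid n \<Delta>" and conn: "circuit_connected n \<Delta>"
    and Cs: "set_mset Cs \<subseteq> circuits n \<Delta>" and C: "C1 \<in># Cs" "C2 \<in># Cs" "C1 \<noteq> C2"
  shows "cprod Cs \<notin> min_expos (symb n \<Delta> (size Cs))"
proof
  assume min: "cprod Cs \<in> min_expos (symb n \<Delta> (size Cs))"
  obtain Ds where Ds: "Cs = add_mset C1 (add_mset C2 Ds)"
    using C by (metis insert_DiffM insert_noteq_member)
  have circ: "C1 \<in> circuits n \<Delta>" "C2 \<in> circuits n \<Delta>" "set_mset Ds \<subseteq> circuits n \<Delta>"
    using Cs by (simp_all add: Ds)
  obtain e where e: "e \<in> C1"
    "\<And>F. F \<in> \<Delta> \<Longrightarrow> e \<notin> F \<Longrightarrow> 3 \<le> card (C1 - F) + card (C2 - F)"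
    using circuit_connected_excess[OF M conn circ(1,2) C(3)] by metis
  have "e \<in> keys (cprod Cs)"
    using e(1) circuit_finite[OF circ(1)] by (simp add: Ds keys_add_expo)
  then have "single e 1 \<preceq> cprod Cs"
    by (simp only: single_expo_le_iff)
  then obtain g where g: "cprod Cs = single e 1 + g"
    by (rule expo_le_addE)
  have "size Cs \<le> weight ({1..n} - F) g" if F: "F \<in> facets \<Delta>" for F
  proof -
    have w: "weight ({1..n} - F) (cprod Cs) = weight ({1..n} - F) (single e 1) + weight ({1..n} - F) g"
      by (simp only: g weight_add)
    show ?thesis
    proof (cases "e \<in> F")
      case True
      have "size Cs \<le> weight ({1..n} - F) (cprod Cs)"
        using cprod_symb[OF M Cs] F by (simp add: symb_def)
      with True w show ?thesis
        by (simp add: weight_single)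
    next
      case False
      have "3 \<le> card (C1 - F) + card (C2 - F)"
        using e(2) facet_independent[OF F] False by blast
      moreover have "size Ds \<le> weight ({1..n} - F) (cprod Ds)"
        using cprod_symb[OF M circ(3)] F by (simp add: symb_def)
      moreover have "weight ({1..n} - F) (cprod Cs) =
        card (C1 - F) + card (C2 - F) + weight ({1..n} - F) (cprod Ds)"
        by (simp add: Ds weight_ind_circuit[OF circ(1)] weight_ind_circuit[OF circ(2)] del: One_nat_def)
      moreover have "weight ({1..n} - F) (single e 1) \<le> 1"
        by (simp add: weight_single)
      ultimately show ?thesis
        using w Ds by simp
    qed
  qed
  moreover have "g \<in> expos n"
    using cprod_expos[OF Cs] by (simp add: g)
  ultimately have "g \<in> symb n \<Delta> (size Cs)"
    by (simp add: symb_def)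
  moreover have "g \<preceq> cprod Cs"
    by (simp add: g)
  ultimately have "g = cprod Cs"
    using min by (simp add: min_expos_def)
  then have "lookup g e = lookup (single e 1 + g) e"
    using g by simp
  then show False
    by (simp add: lookup_add)
qed

text \<open>A monomial of I^l is a multiple of a product of l circuits, which itself lies in I^(l);
  minimality makes the two equal. Such a product cannot have two distinct factors.\<close>

lemma minimal_products_connected:
  assumes M: "matroid n \<Delta>" and conn: "circuit_connected n \<Delta>" and l: "1 \<le> l"
  shows "min_expos (symb n \<Delta> l) \<inter> circuit_prods n \<Delta> l = pure_powers n \<Delta> l"
proof
  show "min_expos (symb n \<Delta> l) \<inter> circuit_prods n \<Delta> l \<subseteq> pure_powers n \<Delta> l"
  proof
    fix e assume e: "e \<in> min_expos (symb n \<Delta> l) \<inter> circuit_prods n \<Delta> l"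
    then obtain Cs where Cs: "size Cs = l" "set_mset Cs \<subseteq> circuits n \<Delta>" "cprod Cs \<preceq> e"
      by (auto simp: circuit_prods_def)
    have eq: "cprod Cs = e"
      using e cprod_symb[OF M Cs(2)] Cs(1,3) by (simp add: min_expos_def)
    \<comment> \<open>A factor exists because l is positive.\<close>
    obtain C where C: "C \<in># Cs"
      using Cs(1) l by (metis multiset_nonemptyE not_one_le_zero size_empty)
    have "\<forall>D\<in>#Cs. D = C"
      using mixed_product_not_minimal[OF M conn Cs(2) _ C] e eq Cs(1) by blast
    then have "Cs = replicate_mset l C"
      using Cs(1) by (metis set_mset_subset_singletonD singleton_iff subsetI)
    with C Cs(2) eq show "e \<in> pure_powers n \<Delta> l"
      unfolding pure_powers_def by blast
  qed
qed (rule pure_powers_subset[OF M])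

lemma minimal_products_not_connected:
  assumes M: "matroid n \<Delta>" and conn: "\<not> circuit_connected n \<Delta>" and l: "2 \<le> l"
  shows "min_expos (symb n \<Delta> l) \<inter> circuit_prods n \<Delta> l \<noteq> pure_powers n \<Delta> l"
proof -
  obtain C1 C2 where C: "C1 \<in> circuits n \<Delta>" "C2 \<in> circuits n \<Delta>" and disj: "C1 \<inter> C2 = {}"
    and only: "\<And>C. C \<in> circuits n \<Delta> \<Longrightarrow> C \<subseteq> C1 \<union> C2 \<Longrightarrow> C = C1 \<or> C = C2"
    using conn unfolding circuit_connected_def by metis
  obtain a b where ab: "a \<in> C1" "b \<in> C2"
    using circuit_ne[OF M] C by (metis ex_in_conv)
  \<comment> \<open>One factor C2 and l - 1 factors C1; since l >= 2, both circuits occur.\<close>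
  define Cs where "Cs = add_mset C2 (replicate_mset (l - 1) C1)"
  have size: "size Cs = l"
    using l by (simp add: Cs_def)
  have Cs: "set_mset Cs \<subseteq> circuits n \<Delta>"
    using C by (auto simp: Cs_def)
  have "cprod Cs \<in> min_expos (symb n \<Delta> l)"
  proof (rule min_expos_symbI)
    show "cprod Cs \<in> symb n \<Delta> l"
      using cprod_symb[OF M Cs] size by simp
    fix i assume "i \<in> keys (cprod Cs)"
    then have "i \<in> C1 \<or> i \<in> C2"
      using circuit_finite[OF C(1)] circuit_finite[OF C(2)]
      by (auto simp: Cs_def keys_add_expo in_keys_iff lookup_cprod_replicate split: if_splits)
    \<comment> \<open>The element i serves as x or y according to the circuit it lies in, and a or b
      fills the other place.\<close>
    then obtain x y where xy: "x \<in> C1" "y \<in> C2" "i = x \<or> i = y"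
      using ab by blast
    obtain F where F: "F \<in> facets \<Delta>" "C1 - F = {x}" "C2 - F = {y}"
      using not_circuit_connected_facet[OF M C only disj xy(1,2)] by blast
    have "weight ({1..n} - F) (cprod Cs) = l"
      using l F by (simp add: Cs_def weight_cprod weight_ind_circuit[OF C(1)] weight_ind_circuit[OF C(2)]
          del: One_nat_def)
    with F xy show "\<exists>F\<in>facets \<Delta>. i \<notin> F \<and> weight ({1..n} - F) (cprod Cs) \<le> l"
      by (intro bexI[of _ F]) auto
  qed
  moreover have "cprod Cs \<in> circuit_prods n \<Delta> l"
    using cprod_circuit_prods[OF Cs] size by simp
  moreover have "cprod Cs \<notin> pure_powers n \<Delta> l"
  proof
    assume "cprod Cs \<in> pure_powers n \<Delta> l"
    then obtain D where D: "D \<in> circuits n \<Delta>" "cprod Cs = cprod (replicate_mset l D)"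
      by (auto simp: pure_powers_def)
    \<comment> \<open>At a only the factors C1 count, so the exponent is l - 1. This lies strictly
      between 0 and l, whereas a pure power has no exponents but 0 and l.\<close>
    have "a \<notin> C2"
      using ab disj by blast
    then have "lookup (cprod Cs) a = l - 1"
      using ab circuit_finite[OF C(1)] circuit_finite[OF C(2)]
      by (simp add: Cs_def lookup_add lookup_ind lookup_cprod_replicate)
    moreover have "lookup (cprod Cs) a \<in> {0, l}"
      using circuit_finite[OF D(1)] by (simp add: D(2) lookup_cprod_replicate)
    ultimately show False
      using l by auto
  qed
  ultimately show ?thesis
    by blast
qed

section \<open>Minimal generators\<close>

lemma min_expos_dependents:
  assumes M: "matroid n \<Delta>"
  shows "min_expos (dependents n \<Delta>) = ind ` circuits n \<Delta>"
proof
  show "min_expos (dependents n \<Delta>) \<subseteq> ind ` circuits n \<Delta>"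
  proof
    fix e assume e: "e \<in> min_expos (dependents n \<Delta>)"
    then have "e \<in> dependents n \<Delta>"
      by (simp add: min_expos_def)
    then obtain C where C: "C \<in> circuits n \<Delta>" "ind C \<preceq> e"
      by (rule dependent_above_circuit)
    with e ind_circuit_dependents[OF C(1)] have "ind C = e"
      by (simp add: min_expos_def)
    with C(1) show "e \<in> ind ` circuits n \<Delta>"
      by blast
  qed
  show "ind ` circuits n \<Delta> \<subseteq> min_expos (dependents n \<Delta>)"
  proof (rule image_subsetI)
    fix C assume C: "C \<in> circuits n \<Delta>"
    have "f = ind C" if f: "f \<in> dependents n \<Delta>" "f \<preceq> ind C" for f
    proof -
      obtain D where D: "D \<in> circuits n \<Delta>" "ind D \<preceq> f"
        using dependent_above_circuit[OF f(1)] .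
      have "ind D \<preceq> ind C"
        using expo_le_trans[OF D(2) f(2)] .
      then have "D \<subseteq> C"
        using circuit_finite[OF C] circuit_finite[OF D(1)] by (simp add: ind_le_iff)
      then have "D = C"
        using circuit_subset_eq[OF D(1) C] by blast
      with D(2) f(2) show ?thesis
        using expo_le_antisym by blast
    qed
    with ind_circuit_dependents[OF C] show "ind C \<in> min_expos (dependents n \<Delta>)"
      by (simp add: min_expos_def)
  qed
qed

lemma inj_on_ind: "inj_on ind (circuits n \<Delta>)"
  by (rule inj_onI) (metis circuit_finite keys_ind)

text \<open>Every generating set of monomials contains all minimal monomials: such a monomial is a
  multiple of a generator, and by minimality equal to it. Hence an inclusion-minimal generating set
  is exactly the set of minimal monomials, which settles the uniqueness behind the definite
  description.\<close>

lemma min_monomial_gens_mono_ideal: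
  assumes A: "expo_ideal n A"
  shows "min_monomial_gens n (mono_ideal A :: 'k::field mpolynomial set) =
    (\<lambda>e. single e 1) ` min_expos A"
proof -
  let ?m = "\<lambda>e. single e (1 :: 'k)"
  have mons: "monomials n = ?m ` expos n"
    by (auto simp: monomials_def expos_def)
  have gen: "Idl\<^bsub>poly_ring n\<^esub> (?m ` E) = mono_ideal A \<longleftrightarrow> up_set n E = A" if "E \<subseteq> expos n" for E
    using genideal_monomials[OF that, where 'k = 'k] by simp
  have inj: "inj ?m"
    by (rule injI) (simp add: single_one_eq_iff)
  have minsub: "min_expos A \<subseteq> expos n"
    using expo_ideal_subset[OF A] by (auto simp: min_expos_def)
  have lower: "min_expos A \<subseteq> E" if E: "E \<subseteq> expos n" "up_set n E = A" for E
  proof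
    fix g assume g: "g \<in> min_expos A"
    then have "g \<in> up_set n E"
      using E(2) by (simp add: min_expos_def)
    then obtain e where e: "e \<in> E" "e \<preceq> g"
      unfolding up_set_def by blast
    have "e \<in> A"
      using subset_up_set[OF E(1)] e(1) E(2) by blast
    with g e have "e = g"
      by (simp add: min_expos_def)
    with e(1) show "g \<in> E" by simp
  qed
  show ?thesis
    unfolding min_monomial_gens_def
  proof (rule the_equality)
    show "?m ` min_expos A \<subseteq> monomials n \<and> Idl\<^bsub>poly_ring n\<^esub> (?m ` min_expos A) = mono_ideal A \<and>
      (\<forall>T. T \<subset> ?m ` min_expos A \<longrightarrow> Idl\<^bsub>poly_ring n\<^esub> T \<noteq> mono_ideal A)"
    proof (intro conjI allI impI)
      show "?m ` min_expos A \<subseteq> monomials n"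
        using minsub by (auto simp: mons)
      show "Idl\<^bsub>poly_ring n\<^esub> (?m ` min_expos A) = mono_ideal A"
        by (simp add: gen[OF minsub] up_set_min_expos[OF A])
      fix T assume T: "T \<subset> ?m ` min_expos A"
      then obtain E where E: "E \<subseteq> min_expos A" "T = ?m ` E"
        by (metis psubset_imp_subset subset_imageE)
      have E': "E \<subseteq> expos n"
        using E(1) minsub by blast
      show "Idl\<^bsub>poly_ring n\<^esub> T \<noteq> mono_ideal A"
      proof
        assume "Idl\<^bsub>poly_ring n\<^esub> T = mono_ideal A"
        then have "min_expos A \<subseteq> E"
          using lower[OF E'] gen[OF E'] E(2) by simp
        with T E(2) show False
          by blast
      qed
    qed
  next
    fix S :: "'k mpolynomial set"
    assume S: "S \<subseteq> monomials n \<and> Idl\<^bsub>poly_ring n\<^esub> S = mono_ideal A \<and>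
      (\<forall>T. T \<subset> S \<longrightarrow> Idl\<^bsub>poly_ring n\<^esub> T \<noteq> mono_ideal A)"
    then obtain E where E: "E \<subseteq> expos n" "S = ?m ` E"
      unfolding mons by (metis subset_imageE)
    have "up_set n E = A"
      using S gen[OF E(1)] E(2) by simp
    then have "?m ` min_expos A \<subseteq> S"
      using lower[OF E(1)] E(2) by blast
    moreover have "Idl\<^bsub>poly_ring n\<^esub> (?m ` min_expos A) = mono_ideal A"
      by (simp add: gen[OF minsub] up_set_min_expos[OF A])
    ultimately show "S = ?m ` min_expos A"
      using S by blast
  qed
qed

lemma min_monomial_gens_stanley_reisner:
  assumes "matroid n \<Delta>"
  shows "min_monomial_gens n (stanley_reisner_ideal n \<Delta>) =
    (\<lambda>C. single (ind C) (1 :: 'k::field)) ` circuits n \<Delta>"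
  by (simp add: stanley_reisner_mono_ideal[OF assms] min_monomial_gens_mono_ideal[OF expo_ideal_dependents[OF assms]]
      min_expos_dependents[OF assms] image_image)

lemma monomial_divides_iff:
  assumes "e \<in> expos n" "f \<in> expos n"
  shows "single e (1 :: 'k::field) divides\<^bsub>poly_ring n\<^esub> single f 1 \<longleftrightarrow> e \<preceq> f"
proof
  assume "single e (1 :: 'k) divides\<^bsub>poly_ring n\<^esub> single f 1"
  then obtain c :: "'k mpolynomial" where "single f 1 = single e 1 * c"
    by (auto simp: factor_def)
  then have "f \<in> keys (single e 1 * c)"
    by (metis keys_single singletonI zero_neq_one)
  with keys_mult[of "single e 1" c] obtain d where "f = e + d"
    by auto
  then show "e \<preceq> f"
    by simp
next
  assume "e \<preceq> f"
  then obtain d where d: "f = e + d"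
    by (rule expo_le_addE)
  with assms(2) show "single e (1 :: 'k) divides\<^bsub>poly_ring n\<^esub> single f 1"
    unfolding factor_def by (intro bexI[of _ "single d 1"]) (simp_all add: mult_single)
qed

lemma support_monomial:
  assumes "e \<in> expos n"
  shows "support n (single e (1 :: 'k::field)) = keys e"
proof -
  have "var i divides\<^bsub>poly_ring n\<^esub> single e (1 :: 'k) \<longleftrightarrow> i \<in> keys e" if "i \<in> {1..n}" for i
  proof -
    have "single i 1 \<in> expos n"
      using that by (simp add: expos_def)
    from monomial_divides_iff[OF this assms, where 'k = 'k] show ?thesis
      by (simp only: var_eq single_expo_le_iff)
  qed
  moreover have "keys e \<subseteq> {1..n}"
    using assms by (simp add: expos_def)
  ultimately show ?thesis
    unfolding support_def by blast
qed

text \<open>Divisibility by a squarefree monomial depends only on supports, so x_C divides x_C1 x_C2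
  iff C is contained in C1 \<union> C2.\<close>

lemma circuit_connected_min_monomial_gens:
  fixes n :: nat and \<Delta> :: "nat set set"
  defines "G \<equiv> min_monomial_gens n (stanley_reisner_ideal n \<Delta> :: 'k::field mpolynomial set)"
  assumes M: "matroid n \<Delta>"
  shows "(\<forall>m1\<in>G. \<forall>m2\<in>G. support n m1 \<inter> support n m2 = {} \<longrightarrow>
      (\<exists>m\<in>G. m \<notin> {m1, m2} \<and> m divides\<^bsub>poly_ring n\<^esub> (m1 \<otimes>\<^bsub>poly_ring n\<^esub> m2))) \<longleftrightarrow>
    circuit_connected n \<Delta>"
proof -
  let ?x = "\<lambda>C. single (ind C) (1 :: 'k)"
  have G: "G = ?x ` circuits n \<Delta>"
    unfolding G_def by (rule min_monomial_gens_stanley_reisner[OF M])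
  have supp: "support n (?x C) = C" if "C \<in> circuits n \<Delta>" for C
    using support_monomial[OF ind_circuit_expos[OF that]] circuit_finite[OF that] by simp
  have inj: "?x C = ?x D \<longleftrightarrow> C = D" if "C \<in> circuits n \<Delta>" "D \<in> circuits n \<Delta>" for C D
    using inj_on_ind that by (auto simp: single_one_eq_iff dest: inj_onD)
  have dvd: "?x C divides\<^bsub>poly_ring n\<^esub> (?x C1 * ?x C2) \<longleftrightarrow> C \<subseteq> C1 \<union> C2"
    if "C \<in> circuits n \<Delta>" "C1 \<in> circuits n \<Delta>" "C2 \<in> circuits n \<Delta>" for C C1 C2
  proof -
    have "?x C divides\<^bsub>poly_ring n\<^esub> (?x C1 * ?x C2) \<longleftrightarrow> ind C \<preceq> ind C1 + ind C2"
      using monomial_divides_iff[of "ind C" n "ind C1 + ind C2", where 'k = 'k] that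
      by (simp add: ind_circuit_expos[of _ n \<Delta>] mult_single)
    then show ?thesis
      using that circuit_finite by (auto simp: ind_le_iff keys_add_expo)
  qed
  show ?thesis
    unfolding G circuit_connected_def ball_simps bex_simps
    by (intro ball_cong refl) (simp add: supp inj dvd cong: bex_cong)
qed

section \<open>The symbolic defect and the equivalences\<close>

text \<open>The difference between the number of generators of I^(l) and the defect counts the
  minimal generators of I^(l) lying in I^l. The pure powers are among these and are as many as the
  generators of I, so equality of numbers becomes equality of finite sets.\<close>

lemma maximal_sdefect_iff:
  fixes n :: nat and \<Delta> :: "nat set set"
  defines "I \<equiv> stanley_reisner_ideal n \<Delta> :: 'k::field mpolynomial set"
  assumes M: "matroid n \<Delta>" and l: "1 \<le> l"
  shows "maximal_sdefect (poly_ring n) I l \<longleftrightarrow>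
    min_expos (symb n \<Delta> l) \<inter> circuit_prods n \<Delta> l = pure_powers n \<Delta> l"
proof -
  let ?A = "min_expos (symb n \<Delta> l)" and ?B = "circuit_prods n \<Delta> l"
  have fin: "finite ?A"
    by (rule finite_min_expos_symb)
  have num_I: "num_gens (poly_ring n) (ideal_module (poly_ring n) I) = card (circuits n \<Delta>)"
    unfolding I_def stanley_reisner_mono_ideal[OF M]
    by (subst num_gens_mono_ideal)
      (simp_all add: expo_ideal_dependents[OF M] min_expos_dependents[OF M] finite_circuits card_image inj_on_ind)
  have num_symb: "num_gens (poly_ring n) (ideal_module (poly_ring n) (symbolic_power (poly_ring n) I l)) = card ?A"
    unfolding I_def symbolic_power_stanley_reisner[OF M]
    by (rule num_gens_mono_ideal[OF expo_ideal_symb fin])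
  have "sdefect (poly_ring n) I l = card (?A - ?B)"
    unfolding sdefect_def I_def symbolic_power_stanley_reisner[OF M] ideal_power_stanley_reisner(2)[OF M]
    by (rule num_gens_mono_ideal_quotient[OF expo_ideal_symb ideal_power_stanley_reisner(1)[OF M]
          circuit_prods_subset_symb[OF M] fin])
  moreover have "card (?A - ?B) + card (?A \<inter> ?B) = card ?A"
    using fin by (subst card_Un_disjoint[symmetric]) (auto intro: arg_cong[where f = card])
  ultimately have "maximal_sdefect (poly_ring n) I l \<longleftrightarrow> card (?A \<inter> ?B) = card (circuits n \<Delta>)"
    unfolding maximal_sdefect_def num_I num_symb by linarith
  also have "\<dots> \<longleftrightarrow> card (pure_powers n \<Delta> l) = card (?A \<inter> ?B)"
    by (auto simp: card_pure_powers[OF l])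
  also have "\<dots> \<longleftrightarrow> ?A \<inter> ?B = pure_powers n \<Delta> l"
    using card_subset_eq[OF _ pure_powers_subset[OF M]] fin by auto
  finally show ?thesis .
qed

theorem theorem5p12:
  fixes n :: nat
    and \<Delta> :: "nat set set"
    and R :: "'k::field mpolynomial ring"
    and I :: "'k mpolynomial set"
  assumes "matroid n \<Delta>"
    and "R = poly_ring n"
    and "I = stanley_reisner_ideal n \<Delta>"
  shows "(two_locally_connected (circuit_graph n \<Delta>) \<longleftrightarrow> (\<forall>l\<ge>1. maximal_sdefect R I l)) \<and>
    (two_locally_connected (circuit_graph n \<Delta>) \<longleftrightarrow> (\<exists>l\<ge>2. maximal_sdefect R I l)) \<and>
    (two_locally_connected (circuit_graph n \<Delta>) \<longleftrightarrow>
       int (sdefect R I 2) =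
         int (num_gens R (ideal_module R (symbolic_power R I 2))) -
         int (num_gens R (ideal_module R I))) \<and>
    (two_locally_connected (circuit_graph n \<Delta>) \<longleftrightarrow>
       (\<forall>m1\<in>min_monomial_gens n I. \<forall>m2\<in>min_monomial_gens n I.
          support n m1 \<inter> support n m2 = {} \<longrightarrow>
          (\<exists>m\<in>min_monomial_gens n I. m \<notin> {m1, m2} \<and> m divides\<^bsub>R\<^esub> (m1 \<otimes>\<^bsub>R\<^esub> m2))))"
proof -
  let ?conn = "circuit_connected n \<Delta>"
  have pos: "maximal_sdefect R I l" if "?conn" "1 \<le> l" for l
    using maximal_sdefect_iff[OF assms(1) that(2), where 'k = 'k]
      minimal_products_connected[OF assms(1) that] by (simp add: assms(2,3))
  \<comment> \<open>Since the positive case covers every l >= 1 and failure occurs at every l >= 2,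
    the exponent 2 alone closes the cycle between "all", "some" and the second defect.\<close>
  have neg: "\<not> maximal_sdefect R I l" if "\<not> ?conn" "2 \<le> l" for l
    using maximal_sdefect_iff[OF assms(1), of l, where 'k = 'k] that(2)
      minimal_products_not_connected[OF assms(1) that] by (simp add: assms(2,3))
  have "?conn \<longleftrightarrow> (\<forall>l\<ge>1. maximal_sdefect R I l)"
    using pos neg[of 2] by (metis one_le_numeral order_refl)
  moreover have "?conn \<longleftrightarrow> (\<exists>l\<ge>2. maximal_sdefect R I l)"
    using pos[of 2] neg by (metis one_le_numeral order_refl)
  moreover have "?conn \<longleftrightarrow> maximal_sdefect R I 2"
    using pos[of 2] neg[of 2] by (metis one_le_numeral order_refl)
  moreover note circuit_connected_min_monomial_gens[OF assms(1), where 'k = 'k]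
  ultimately show ?thesis
    unfolding two_locally_connected_circuit_graph[OF assms(1)] maximal_sdefect_def[of R I 2]
    by (simp only: assms(2,3))
qed

end
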